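(* Let $n,r$ be positive integers. If $(a,b)$ is the $\mathcal{I}_n$-decomposition of the colored derangement polynomial $d_{n,r}(z)$, then both $a$ and $b$ are real-rooted. In particular, the local $h$-polynomial of the $r$-th edgewise subdivision of the barycentric subdivision of $2^{[n]}$ is real-rooted.
   Context: An $r$-colored permutation is $(\pi,c)$ with $\pi\in\mathfrak{S}_n$, $c\in\{0,\ldots,r-1\}^n$; $i$ is an excedance if $\pi_i>i$ or ($\pi_i=i$ and $c_i>0$); derangements have no fixed point of color $0$; $d_{n,r}(z)=\sum z^{\mathrm{exc}(\sigma)}$ over $r$-colored derangements of length $n$. The $\mathcal{I}_n$-decomposition of a polynomial $p$ of degree at most $n$ is the unique pair $(a,b)$ with $p=a+zb$, $a(z)=z^na(1/z)$, $b(z)=z^{n-1}b(1/z)$, $\deg a\le n$, $\deg b\le n-1$. Real-rooted means all zeros real or identically zero. The barycentric subdivision of $2^{[n]}$ has vertices the nonempty subsets of $[n]$ and faces the chains; its $r$-th edgewise subdivision applies to each face (vertices ordered by inclusion) the $r$-th edgewise subdivision of a simplex with ordered vertices $v_1<\dots<v_k$: vertices $x\in\mathbb{Z}^k_{\ge0}$ with $\sum x_i=r$, faces the sets $F$ with $\varphi(x)-\varphi(y)$ or $\varphi(y)-\varphi(x)$ in $\{0,1\}^k$ for all $x,y\in F$, where $\varphi(x)=(x_1,x_1+x_2,\ldots,x_1+\cdots+x_k)$. For a $(d-1)$-dimensional complex $\Omega$, $h(\Omega;z)=\sum_{i=0}^d f_{i-1}z^i(1-z)^{d-i}$; for a subdivision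 $\Omega$ of $2^V$, $|V|=n$, the local $h$-polynomial is $\sum_{F\subseteq V}(-1)^{n-|F|}h(\Omega_F;z)$, $\Omega_F$ the restriction to $F$ and $h(\Omega_\emptyset;z)=1$. *)

theory Defs
  imports "HOL-Computational_Algebra.Polynomial" "HOL-Combinatorics.Permutations"
          "HOL-Library.FuncSet" Complex_Main
begin

definition real_rooted :: "real poly \<Rightarrow> bool" where
  "real_rooted p \<longleftrightarrow> p = 0 \<or>
     (\<forall>z::complex. poly (map_poly complex_of_real p) z = 0 \<longrightarrow> z \<in> \<real>)"

definition colored_derangements :: "nat \<Rightarrow> nat \<Rightarrow> ((nat \<Rightarrow> nat) \<times> (nat \<Rightarrow> nat)) set" where
  "colored_derangements n r =
     {(\<pi>, c). \<pi> permutes {1..n} \<and> c \<in> {1..n} \<rightarrow>\<^sub>E {0..<r} \<and>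
              (\<forall>i\<in>{1..n}. \<pi> i = i \<longrightarrow> c i \<noteq> 0)}"

definition cexc :: "nat \<Rightarrow> (nat \<Rightarrow> nat) \<times> (nat \<Rightarrow> nat) \<Rightarrow> nat" where
  "cexc n \<sigma> = card {i\<in>{1..n}. fst \<sigma> i > i \<or> (fst \<sigma> i = i \<and> snd \<sigma> i > 0)}"

definition colored_derangement_poly :: "nat \<Rightarrow> nat \<Rightarrow> real poly" where
  "colored_derangement_poly n r = (\<Sum>\<sigma>\<in>colored_derangements n r. monom 1 (cexc n \<sigma>))"

text \<open>p(z) = z^m p(1/z) with deg p <= m, written out coefficientwise.\<close>
definition symmetric_wrt :: "nat \<Rightarrow> real poly \<Rightarrow> bool" where
  "symmetric_wrt m p \<longleftrightarrow> degree p \<le> m \<and> (\<forall>i\<le>m. coeff p i = coeff p (m - i))"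

definition In_decomposition :: "nat \<Rightarrow> real poly \<Rightarrow> real poly \<Rightarrow> real poly \<Rightarrow> bool" where
  "In_decomposition n p a b \<longleftrightarrow>
     p = a + [:0, 1:] * b \<and> symmetric_wrt n a \<and> symmetric_wrt (n - 1) b"

text \<open>A vertex is a point of the r-th edgewise subdivision of some face (chain) of the
  barycentric subdivision: a function from nonempty subsets of {1..n} to naturals whose
  support is a chain and whose values sum to r.\<close>
definition esd_vertices :: "nat \<Rightarrow> nat \<Rightarrow> (nat set \<Rightarrow> nat) set" where
  "esd_vertices n r = {x. (\<forall>S. x S \<noteq> 0 \<longrightarrow> S \<noteq> {} \<and> S \<subseteq> {1..n}) \<and>
       (\<forall>S T. x S \<noteq> 0 \<longrightarrow> x T \<noteq> 0 \<longrightarrow> S \<subseteq> T \<or> T \<subseteq> S) \<and>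
       (\<Sum>S\<in>Pow {1..n}. x S) = r}"

definition is_bchain :: "nat \<Rightarrow> nat set set \<Rightarrow> bool" where
  "is_bchain n C \<longleftrightarrow> C \<subseteq> Pow {1..n} - {{}} \<and> (\<forall>S\<in>C. \<forall>T\<in>C. S \<subseteq> T \<or> T \<subseteq> S)"

definition esd_phi :: "nat set set \<Rightarrow> (nat set \<Rightarrow> nat) \<Rightarrow> nat set \<Rightarrow> int" where
  "esd_phi C x T = int (\<Sum>S\<in>{S\<in>C. S \<subseteq> T}. x S)"

definition esd_faces :: "nat \<Rightarrow> nat \<Rightarrow> (nat set \<Rightarrow> nat) set set" where
  "esd_faces n r = {F. F \<subseteq> esd_vertices n r \<and> finite F \<and>
     (\<exists>C. is_bchain n C \<and> (\<forall>x\<in>F. \<forall>S. x S \<noteq> 0 \<longrightarrow> S \<in> C) \<and>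
        (\<forall>x\<in>F. \<forall>y\<in>F. (\<forall>T\<in>C. esd_phi C x T - esd_phi C y T \<in> {0, 1}) \<or>
                        (\<forall>T\<in>C. esd_phi C y T - esd_phi C x T \<in> {0, 1})))}"

definition esd_restrict :: "nat \<Rightarrow> nat \<Rightarrow> nat set \<Rightarrow> (nat set \<Rightarrow> nat) set set" where
  "esd_restrict n r G = {F\<in>esd_faces n r. \<forall>x\<in>F. \<forall>S. x S \<noteq> 0 \<longrightarrow> S \<subseteq> G}"

text \<open>h-polynomial of a (d-1)-dimensional complex given by its set of faces.\<close>
definition h_poly :: "nat \<Rightarrow> 'v set set \<Rightarrow> real poly" where
  "h_poly d \<Omega> = (\<Sum>i=0..d. smult (real (card {F\<in>\<Omega>. card F = i}))
                          ([:0, 1:] ^ i * [:1, -1:] ^ (d - i)))"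

definition local_h_esd :: "nat \<Rightarrow> nat \<Rightarrow> real poly" where
  "local_h_esd n r = (\<Sum>G\<in>Pow {1..n}.
      smult ((-1) ^ (n - card G)) (h_poly (card G) (esd_restrict n r G)))"

end

theory Submission
  imports Defs
begin

text \<open>
  Let \<open>P\<^sub>n(\<alpha>, z)\<close> enumerate the permutations of \<open>{1..n}\<close> by fixed points (\<open>\<alpha>\<close>) and excedances (\<open>z\<close>),
  and let \<open>A\<^sub>n(z) = P\<^sub>n(1, z)\<close> be the Eulerian polynomial. Two facts drive everything:
  \<open>\<partial>P\<^sub>n/\<partial>\<alpha> = n P\<^sub>n\<^sub>-\<^sub>1\<close> and \<open>P\<^sub>n(z, z) = z A\<^sub>n(z)\<close>. For fixed \<open>z < 0\<close> they imply, by induction on \<open>n\<close>,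
  that \<open>P\<^sub>n(-, z)\<close> changes sign at most once on \<open>(z, 1)\<close>: its derivative changes sign at most once,
  and its values at the two ends have opposite signs. When \<open>A\<^sub>n(z) = 0\<close> both end values vanish, so
  \<open>P\<^sub>n(-, z)\<close> has a constant sign on \<open>(z, 1)\<close>, and this sign alternates along the \<open>n - 1\<close> negative
  zeros of \<open>A\<^sub>n\<close>.

  With \<open>c = (r - 1)/r\<close>, the colored derangement polynomial is \<open>r\<^sup>n P\<^sub>n(cz, z)\<close>, its reversal is
  \<open>r\<^sup>n P\<^sub>n(c, z)\<close>, and hence \<open>(1 - z) a = r\<^sup>n (P\<^sub>n(cz, z) - z P\<^sub>n(c, z))\<close> and
  \<open>(z - 1) b = r\<^sup>n (P\<^sub>n(cz, z) - P\<^sub>n(c, z))\<close>. Both \<open>cz\<close> and \<open>c\<close> lie in \<open>(z, 1)\<close>, so \<open>a\<close> alternates along the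
  zeros of \<open>A\<^sub>n\<close>; since \<open>P\<^sub>n(-, z)\<close> is monotone on \<open>(z, 1)\<close> at each zero \<open>z\<close> of \<open>A\<^sub>n\<^sub>-\<^sub>1\<close>, \<open>b\<close> alternates
  along the zeros of \<open>A\<^sub>n\<^sub>-\<^sub>1\<close>.

  The number of faces of the edgewise subdivision is read off from lattice points: the h-polynomial
  of its restriction to a nonempty set of size \<open>k\<close> is \<open>(1 - z)\<^sup>k \<Sum>\<^sub>m ((rm + 1)\<^sup>k - (rm)\<^sup>k) z\<^sup>m\<close>.
  Summing over all restrictions shows that the local h-polynomial satisfies the equation for \<open>a\<close>.
\<close>

section \<open>Enumerating permutations by excedances and fixed points\<close>

text \<open>A separate weight \<open>y\<close> for anti-excedances makes the enumerator below
  homogeneous of degree \<open>n\<close> and exposes its symmetry in \<open>x\<close> and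
  \<open>y\<close>; the polynomials of interest appear at \<open>y = 1\<close>.\<close>

definition exc_weight :: "'a \<Rightarrow> 'a \<Rightarrow> 'a \<Rightarrow> nat \<Rightarrow> nat \<Rightarrow> 'a" where
  "exc_weight \<alpha> x y i j = (if i < j then x else if j = i then \<alpha> else y)"

definition exc_enum :: "nat \<Rightarrow> 'a \<Rightarrow> 'a \<Rightarrow> 'a \<Rightarrow> 'a::comm_ring_1" where
  "exc_enum n \<alpha> x y = (\<Sum>\<pi> | \<pi> permutes {1..n}. \<Prod>i\<in>{1..n}. exc_weight \<alpha> x y i (\<pi> i))"

text \<open>The derivative in direction (1, 1, 1), written as a sum over a marked arc so that it
  makes sense over every commutative ring.\<close>

definition exc_enum_deriv :: "nat \<Rightarrow> 'a \<Rightarrow> 'a \<Rightarrow> 'a \<Rightarrow> 'a::comm_ring_1" where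
  "exc_enum_deriv n \<alpha> x y =
     (\<Sum>\<pi> | \<pi> permutes {1..n}. \<Sum>j\<in>{1..n}. \<Prod>i\<in>{1..n} - {j}. exc_weight \<alpha> x y i (\<pi> i))"

lemma exc_enum_0 [simp]: "exc_enum 0 \<alpha> x y = 1"
  by (simp add: exc_enum_def)

lemma exc_enum_deriv_0 [simp]: "exc_enum_deriv 0 \<alpha> x y = 0"
  by (simp add: exc_enum_deriv_def)

text \<open>A permutation of \<open>{1..n+1}\<close> fixes \<open>n + 1\<close>, or arises by inserting \<open>n + 1\<close> into an arc
  \<open>j \<mapsto> q j\<close>, which trades the weight of that arc for one excedance and one anti-excedance.\<close>

lemma exc_enum_Suc:
  "exc_enum (Suc n) \<alpha> x y = \<alpha> * exc_enum n \<alpha> x y + x * y * exc_enum_deriv n \<alpha> x y"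
proof -
  let ?w = "exc_weight \<alpha> x y"
  let ?S = "{1..n}" and ?a = "Suc n"
  define f where "f \<sigma> = (\<Prod>i\<in>insert ?a ?S. ?w i (\<sigma> i))" for \<sigma>
  have ins: "{1..Suc n} = insert ?a ?S"
    by auto
  have fixed: "f (transpose ?a ?a \<circ> q) = \<alpha> * (\<Prod>i\<in>?S. ?w i (q i))" if q: "q permutes ?S" for q
  proof -
    have "q ?a = ?a"
      using q by (simp add: permutes_not_in)
    then show ?thesis
      by (simp add: f_def exc_weight_def)
  qed
  have moved: "(\<Sum>b\<in>?S. f (transpose ?a b \<circ> q)) = x * y * (\<Sum>j\<in>?S. \<Prod>i\<in>?S - {j}. ?w i (q i))"
    if q: "q permutes ?S" for q
  proof -
    have qa: "q ?a = ?a"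
      using q by (simp add: permutes_not_in)
    \<comment> \<open>With \<open>b = q j\<close> the new permutation sends \<open>j\<close> to
      \<open>Suc n\<close> and \<open>Suc n\<close> to \<open>q j\<close>, so the sum over
      \<open>b\<close> becomes a sum over the arcs of \<open>q\<close>.\<close>
    have "f (transpose ?a (q j) \<circ> q) = x * y * (\<Prod>i\<in>?S - {j}. ?w i (q i))" if j: "j \<in> ?S" for j
    proof -
      have qj: "q j \<in> ?S"
        using permutes_in_image[OF q] j by blast
      let ?\<sigma> = "transpose ?a (q j) \<circ> q"
      have "f ?\<sigma> = ?w ?a (?\<sigma> ?a) * (?w j (?\<sigma> j) * (\<Prod>i\<in>?S - {j}. ?w i (?\<sigma> i)))"
        unfolding f_def prod.remove[OF finite_atLeastAtMost j, of "\<lambda>i. ?w i (?\<sigma> i)", symmetric]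
        by (rule prod.insert) auto
      moreover have "?w ?a (?\<sigma> ?a) = y"
        using qj by (auto simp: qa exc_weight_def)
      moreover have "?w j (?\<sigma> j) = x"
        using j by (auto simp: exc_weight_def)
      moreover have "?\<sigma> i = q i" if "i \<in> ?S - {j}" for i
      proof -
        have "q i \<in> ?S" "q i \<noteq> q j"
          using permutes_in_image[OF q] that permutes_inj[OF q] by (auto simp: inj_eq simp del: atLeastAtMost_iff)
        then show ?thesis
          by (auto simp: transpose_def)
      qed
      ultimately show ?thesis
        by (simp add: mult_ac)
    qed
    then have "(\<Sum>j\<in>?S. f (transpose ?a (q j) \<circ> q)) = x * y * (\<Sum>j\<in>?S. \<Prod>i\<in>?S - {j}. ?w i (q i))"
      by (simp add: sum_distrib_left)
    moreover have "(\<Sum>j\<in>?S. f (transpose ?a (q j) \<circ> q)) = (\<Sum>b\<in>?S. f (transpose ?a b \<circ> q))"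
      by (rule sum.reindex_bij_betw[OF permutes_imp_bij[OF q]])
    ultimately show ?thesis
      by simp
  qed
  have "exc_enum (Suc n) \<alpha> x y = (\<Sum>\<sigma> | \<sigma> permutes insert ?a ?S. f \<sigma>)"
    unfolding exc_enum_def f_def ins ..
  also have "\<dots> = (\<Sum>b\<in>insert ?a ?S. \<Sum>q | q permutes ?S. f (transpose ?a b \<circ> q))"
    by (rule sum_over_permutations_insert) auto
  also have "\<dots> = (\<Sum>q | q permutes ?S. f (transpose ?a ?a \<circ> q))
      + (\<Sum>b\<in>?S. \<Sum>q | q permutes ?S. f (transpose ?a b \<circ> q))"
    by (subst sum.insert) auto
  also have "(\<Sum>b\<in>?S. \<Sum>q | q permutes ?S. f (transpose ?a b \<circ> q))
      = (\<Sum>q | q permutes ?S. \<Sum>b\<in>?S. f (transpose ?a b \<circ> q))"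
    by (rule sum.swap)
  also have "\<dots> = (\<Sum>q | q permutes ?S. x * y * (\<Sum>j\<in>?S. \<Prod>i\<in>?S - {j}. ?w i (q i)))"
    by (intro sum.cong) (simp_all only: mem_Collect_eq moved)
  also have "(\<Sum>q | q permutes ?S. f (transpose ?a ?a \<circ> q))
      = (\<Sum>q | q permutes ?S. \<alpha> * (\<Prod>i\<in>?S. ?w i (q i)))"
    by (intro sum.cong) (simp_all only: mem_Collect_eq fixed)
  finally show ?thesis
    by (simp add: exc_enum_def exc_enum_deriv_def sum_distrib_left)
qed

text \<open>Shifting all three weights by \<open>s\<close> adds \<open>s\<close> to every factor,
  whatever the type of its arc, so the product rule produces the marked sum.\<close>

lemma has_field_derivative_exc_enum:
  fixes \<alpha> x y :: real
  shows "((\<lambda>s. exc_enum n (\<alpha> + s) (x + s) (y + s)) has_field_derivative exc_enum_deriv n \<alpha> x y) (at 0)"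
proof -
  have w: "exc_weight (\<alpha> + s) (x + s) (y + s) i j = exc_weight \<alpha> x y i j + s" for s i j
    by (simp add: exc_weight_def)
  have p: "((\<lambda>s. \<Prod>i\<in>{1..n}. exc_weight \<alpha> x y i (\<pi> i) + s) has_field_derivative
      (\<Sum>j\<in>{1..n}. \<Prod>i\<in>{1..n} - {j}. exc_weight \<alpha> x y i (\<pi> i))) (at 0)" for \<pi>
  proof -
    have "((\<lambda>s. exc_weight \<alpha> x y i (\<pi> i) + s) has_field_derivative 1) (at 0)" for i
      by (auto intro!: derivative_eq_intros)
    from has_field_derivative_prod[of "{1..n}", OF this] show ?thesis
      by simp
  qed
  show ?thesis
    unfolding exc_enum_def exc_enum_deriv_def w by (intro DERIV_sum p)
qed

text \<open>In the recursion only the derivative term needs an argument: it is determined by the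
  values for size \<open>n\<close>, which are symmetric at all arguments by induction.\<close>

lemma exc_enum_commute:
  fixes \<alpha> x y :: real
  shows "exc_enum n \<alpha> x y = exc_enum n \<alpha> y x"
proof (induction n arbitrary: \<alpha> x y)
  case (Suc n)
  have "exc_enum_deriv n \<alpha> x y = exc_enum_deriv n \<alpha> y x"
    using has_field_derivative_exc_enum[of n \<alpha> x y] has_field_derivative_exc_enum[of n \<alpha> y x]
    by (subst (asm) Suc.IH) (rule DERIV_unique)
  then show ?case
    using Suc.IH[of \<alpha> x y] by (simp add: exc_enum_Suc)
qed simp

lemma exc_enum_homogeneous: "exc_enum n (k * \<alpha>) (k * x) (k * y) = k ^ n * exc_enum n \<alpha> x y"
proof -
  have "exc_weight (k * \<alpha>) (k * x) (k * y) i j = k * exc_weight \<alpha> x y i j" for i j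
    by (simp add: exc_weight_def)
  then show ?thesis
    by (simp add: exc_enum_def prod.distrib sum_distrib_left)
qed

text \<open>With \<open>y = 1\<close> this is the relation between weak and strict excedances.
  Differentiating the identity for \<open>n\<close> along (1, 1, 1) yields exactly the relation
  between derivatives that the recursion requires.\<close>

lemma exc_enum_weak:
  fixes x y :: real
  assumes "n > 0"
  shows "y * exc_enum n x x y = x * exc_enum n y x y"
  using assms
proof (induction n arbitrary: x y rule: nat_induct_non_zero)
  case 1
  show ?case
    by (simp add: exc_enum_Suc[of 0, simplified])
next
  case (Suc n)
  have "((\<lambda>s. (y + s) * exc_enum n (x + s) (x + s) (y + s)) has_field_derivative
      exc_enum n x x y + y * exc_enum_deriv n x x y) (at 0)"
    by (auto intro!: derivative_eq_intros has_field_derivative_exc_enum)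
  moreover have "((\<lambda>s. (x + s) * exc_enum n (y + s) (x + s) (y + s)) has_field_derivative
      exc_enum n y x y + x * exc_enum_deriv n y x y) (at 0)"
    by (auto intro!: derivative_eq_intros has_field_derivative_exc_enum)
  ultimately have "exc_enum n x x y + y * exc_enum_deriv n x x y
      = exc_enum n y x y + x * exc_enum_deriv n y x y"
    by (subst (asm) Suc.IH) (rule DERIV_unique)
  then have d: "y * exc_enum_deriv n x x y
      = exc_enum n y x y + x * exc_enum_deriv n y x y - exc_enum n x x y"
    by simp
  have "y * exc_enum (Suc n) x x y = x * y * exc_enum n x x y + x * y * (y * exc_enum_deriv n x x y)"
    by (simp add: exc_enum_Suc algebra_simps)
  then show ?case
    unfolding d by (simp add: exc_enum_Suc algebra_simps)
qed

text \<open>An Appell expansion about \<alpha> = y. The difference \<alpha> - y is constant along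
  (1, 1, 1), so differentiating the expansion affects only the factors
  \<open>exc_enum k y x y\<close>; the recursion then reduces to Pascal's rule.\<close>

lemma exc_enum_appell:
  fixes \<alpha> x y :: real
  shows "exc_enum n \<alpha> x y = (\<Sum>k\<le>n. (n choose k) * (\<alpha> - y) ^ (n - k) * exc_enum k y x y)"
proof (induction n arbitrary: \<alpha> x y)
  case (Suc n)
  define t where "t = \<alpha> - y"
  let ?E = "\<lambda>k. exc_enum k y x y"
  have "((\<lambda>s. \<Sum>k\<le>n. (n choose k) * t ^ (n - k) * exc_enum k (y + s) (x + s) (y + s))
      has_field_derivative (\<Sum>k\<le>n. (n choose k) * t ^ (n - k) * exc_enum_deriv k y x y)) (at 0)"
    by (intro DERIV_sum DERIV_cmult has_field_derivative_exc_enum)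
  moreover have "exc_enum n (\<alpha> + s) (x + s) (y + s)
      = (\<Sum>k\<le>n. (n choose k) * t ^ (n - k) * exc_enum k (y + s) (x + s) (y + s))" for s
    unfolding Suc.IH[of "\<alpha> + s"] by (simp add: t_def)
  ultimately have d: "exc_enum_deriv n \<alpha> x y
      = (\<Sum>k\<le>n. (n choose k) * t ^ (n - k) * exc_enum_deriv k y x y)"
    using has_field_derivative_exc_enum[of n \<alpha> x y] by (simp add: DERIV_unique)
  have IH: "exc_enum n \<alpha> x y = (\<Sum>k\<le>n. (n choose k) * t ^ (n - k) * ?E k)"
    unfolding Suc.IH[of \<alpha>] by (simp add: t_def)
  have "exc_enum (Suc n) \<alpha> x y = t * exc_enum n \<alpha> x y + (y * exc_enum n \<alpha> x y + x * y * exc_enum_deriv n \<alpha> x y)"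
    by (simp add: exc_enum_Suc t_def algebra_simps)
  also have "y * exc_enum n \<alpha> x y + x * y * exc_enum_deriv n \<alpha> x y
      = (\<Sum>k\<le>n. (n choose k) * t ^ (n - k) * ?E (Suc k))"
    unfolding IH d by (simp add: exc_enum_Suc sum_distrib_left sum.distrib[symmetric] algebra_simps)
  also have "t * exc_enum n \<alpha> x y = (\<Sum>k\<le>n. (n choose k) * t ^ (Suc n - k) * ?E k)"
    unfolding IH sum_distrib_left by (intro sum.cong) (auto simp: Suc_diff_le)
  also have "\<dots> = (\<Sum>k\<le>Suc n. (n choose k) * t ^ (Suc n - k) * ?E k)"
    by simp
  also have "\<dots> = t ^ Suc n + (\<Sum>k\<le>n. (n choose Suc k) * t ^ (n - k) * ?E (Suc k))"
    by (subst sum.atMost_Suc_shift) simp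
  finally have "exc_enum (Suc n) \<alpha> x y = t ^ Suc n
      + (\<Sum>k\<le>n. (Suc n choose Suc k) * t ^ (n - k) * ?E (Suc k))"
    by (simp add: sum.distrib[symmetric] algebra_simps)
  also have "\<dots> = (\<Sum>k\<le>Suc n. (Suc n choose k) * t ^ (Suc n - k) * ?E k)"
    by (subst sum.atMost_Suc_shift) simp
  finally show ?case
    by (simp add: t_def)
qed simp

text \<open>Only the powers of \<alpha> - y in the Appell expansion depend on \<alpha>; termwise
  differentiation and binomial absorption lead back to the expansion of size
  \<open>n\<close>.\<close>

lemma has_field_derivative_exc_enum_fixed:
  fixes \<alpha> x y :: real
  shows "((\<lambda>\<alpha>. exc_enum (Suc n) \<alpha> x y) has_field_derivative Suc n * exc_enum n \<alpha> x y) (at \<alpha>)"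
proof -
  have "((\<lambda>\<alpha>. \<Sum>k\<le>Suc n. (Suc n choose k) * (\<alpha> - y) ^ (Suc n - k) * exc_enum k y x y) has_field_derivative
     (\<Sum>k\<le>Suc n. (Suc n choose k) * ((Suc n - k) * (\<alpha> - y) ^ (Suc n - k - 1)) * exc_enum k y x y)) (at \<alpha>)"
    by (intro DERIV_sum) (auto intro!: derivative_eq_intros)
  also have "(\<Sum>k\<le>Suc n. (Suc n choose k) * ((Suc n - k) * (\<alpha> - y) ^ (Suc n - k - 1)) * exc_enum k y x y)
     = (\<Sum>k\<le>n. (Suc n choose k) * ((Suc n - k) * (\<alpha> - y) ^ (Suc n - k - 1)) * exc_enum k y x y)"
    by simp
  also have "\<dots> = (\<Sum>k\<le>n. Suc n * ((n choose k) * (\<alpha> - y) ^ (n - k) * exc_enum k y x y))"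
  proof (intro sum.cong refl)
    fix k assume "k \<in> {..n}"
    then have "(Suc n - k) * (Suc n choose k) = Suc n * (n choose k)"
      using binomial_absorb_comp[of "Suc n" k] by simp
    then have "real (Suc n choose k) * real (Suc n - k) = real (Suc n) * real (n choose k)"
      by (metis mult.commute of_nat_mult)
    then show "(Suc n choose k) * ((Suc n - k) * (\<alpha> - y) ^ (Suc n - k - 1)) * exc_enum k y x y
        = Suc n * ((n choose k) * (\<alpha> - y) ^ (n - k) * exc_enum k y x y)"
      by (simp only: mult.assoc[symmetric]) simp
  qed
  also have "\<dots> = Suc n * exc_enum n \<alpha> x y"
    unfolding exc_enum_appell[of n \<alpha>] sum_distrib_left ..
  finally show ?thesis
    unfolding exc_enum_appell[of "Suc n" _ x y] .
qed

lemma poly_exc_enum: "poly (exc_enum n p q u) z = exc_enum n (poly p z) (poly q z) (poly u z)"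
proof -
  have "poly (exc_weight p q u i j) z = exc_weight (poly p z) (poly q z) (poly u z) i j" for i j
    by (simp add: exc_weight_def)
  then show ?thesis
    by (simp add: exc_enum_def poly_sum poly_prod)
qed

section \<open>Zeros of the Eulerian polynomials\<close>

lemma strict_dec_imp_less:
  fixes f :: "nat \<Rightarrow> real"
  assumes "\<And>i. i < m \<Longrightarrow> f (Suc i) < f i" "i < j" "j \<le> m"
  shows "f j < f i"
  using assms(2,3)
proof (induction j)
  case (Suc j)
  then show ?case
    using assms(1)[of j] by (cases "i = j") auto
qed simp

lemma alternating_roots:
  fixes p :: "real poly" and x :: "nat \<Rightarrow> real"
  assumes dec: "\<And>i. i < m \<Longrightarrow> x (Suc i) < x i"
    and alt: "\<And>i. i \<le> m \<Longrightarrow> 0 < (- 1) ^ i * poly p (x i)"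
  obtains \<rho> where "\<And>i. i < m \<Longrightarrow> x (Suc i) < \<rho> i \<and> \<rho> i < x i \<and> poly p (\<rho> i) = 0"
proof -
  have "\<exists>y. x (Suc i) < y \<and> y < x i \<and> poly p y = 0" if "i < m" for i
  proof -
    have "0 < ((- 1) ^ i * poly p (x i)) * ((- 1) ^ Suc i * poly p (x (Suc i)))"
      using that by (intro mult_pos_pos alt) auto
    also have "\<dots> = - (poly p (x (Suc i)) * poly p (x i)) * ((- 1) ^ i * (- 1) ^ i)"
      by (simp add: algebra_simps)
    also have "((- 1) ^ i * (- 1) ^ i :: real) = 1"
      by (simp flip: power_mult_distrib)
    finally show ?thesis
      using poly_IVT[OF dec[OF that], of p] by auto
  qed
  then show ?thesis
    using that by metis
qed

lemma poly_map_poly_of_real: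
  "poly (map_poly complex_of_real p) (of_real x) = of_real (poly p x)"
  by (simp add: poly_altdef degree_map_poly coeff_map_poly)

text \<open>The alternation yields \<open>m\<close> real zeros, and the degree leaves room for only one more, whereas
  non-real zeros come in conjugate pairs.\<close>

lemma real_rooted_if_alternating:
  fixes p :: "real poly" and x :: "nat \<Rightarrow> real"
  assumes deg: "degree p \<le> Suc m"
    and dec: "\<And>i. i < m \<Longrightarrow> x (Suc i) < x i"
    and alt: "\<And>i. i \<le> m \<Longrightarrow> 0 < (- 1) ^ i * poly p (x i)"
  shows "real_rooted p"
proof -
  let ?P = "map_poly complex_of_real p"
  obtain \<rho> where \<rho>: "\<And>i. i < m \<Longrightarrow> x (Suc i) < \<rho> i \<and> \<rho> i < x i \<and> poly p (\<rho> i) = 0"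
    using alternating_roots[OF dec alt] by metis
  have "\<rho> (Suc i) < \<rho> i" if "Suc i < m" for i
    using \<rho>[of i] \<rho>[of "Suc i"] that by linarith
  then have \<rho>_dec: "\<rho> j < \<rho> i" if "i < j" "j < m" for i j
    using strict_dec_imp_less[of "m - 1" \<rho> i j] that by auto
  then have inj: "inj_on \<rho> {..<m}"
    by (intro inj_onI) (metis lessThan_iff less_irrefl linorder_neqE_nat)
  have "poly p (x 0) \<noteq> 0"
    using alt[of 0] by auto
  then have "?P \<noteq> 0"
    using poly_map_poly_of_real[of p "x 0"] by auto
  have real: "coeff ?P i \<in> \<real>" for i
    by (simp add: coeff_map_poly)
  have "z \<in> \<real>" if z: "poly ?P z = 0" for z
  proof (rule ccontr)
    assume nz: "z \<notin> \<real>"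
    then have "cnj z \<noteq> z"
      by (simp add: Reals_cnj_iff)
    let ?R = "(\<lambda>i. complex_of_real (\<rho> i)) ` {..<m}"
    have "card ?R = m"
      using inj by (subst card_image) (auto simp: inj_on_def)
    moreover have "z \<notin> ?R" "cnj z \<notin> ?R"
      using nz by (auto simp: complex_cnj_complex_of_real) (metis Reals_of_real complex_cnj_cnj complex_cnj_complex_of_real)
    ultimately have "card (insert z (insert (cnj z) ?R)) = m + 2"
      using \<open>cnj z \<noteq> z\<close> by (simp add: card_insert_if)
    moreover have "insert z (insert (cnj z) ?R) \<subseteq> {w. poly ?P w = 0}"
      using z \<rho> real_poly_cnj_root_iff[of ?P z, OF real] by (auto simp: poly_map_poly_of_real)
    then have "card (insert z (insert (cnj z) ?R)) \<le> card {w. poly ?P w = 0}"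
      using \<open>?P \<noteq> 0\<close> by (intro card_mono poly_roots_finite)
    moreover have "card {w. poly ?P w = 0} \<le> degree ?P"
      using \<open>?P \<noteq> 0\<close> by (rule card_poly_roots_bound)
    ultimately show False
      using deg by (simp add: degree_map_poly)
  qed
  then show ?thesis
    by (simp add: real_rooted_def)
qed

text \<open>With \<open>m\<close> distinct zeros and degree at most \<open>m\<close>, the polynomial
  is a constant times the product of the z - \<eta> j. The zeros are negative and the value at 0 is
  positive, so the constant is positive; the \<open>i\<close> zeros to the right of \<open>y\<close>
  supply the sign.\<close>

lemma poly_sign_between_roots:
  fixes p :: "real poly" and \<eta> :: "nat \<Rightarrow> real"
  assumes deg: "degree p \<le> m" and pos: "0 < poly p 0"
    and root: "\<And>j. j < m \<Longrightarrow> poly p (\<eta> j) = 0 \<and> \<eta> j < 0"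
    and inj: "inj_on \<eta> {..<m}"
    and i: "i \<le> m"
    and left: "\<And>j. i \<le> j \<Longrightarrow> j < m \<Longrightarrow> \<eta> j < y"
    and right: "\<And>j. j < i \<Longrightarrow> y < \<eta> j"
  shows "0 < (- 1) ^ i * poly p y"
proof -
  define q where "q = (\<Prod>j<m. [:- \<eta> j, 1:])"
  have "degree q = m"
    unfolding q_def by (subst degree_prod_eq_sum_degree) auto
  moreover have "lead_coeff q = 1"
    by (simp add: q_def lead_coeff_prod)
  ultimately have "coeff p m = coeff (smult (coeff p m) q) m"
    by simp
  moreover have "card (\<eta> ` {..<m}) = m"
    using inj by (simp add: card_image)
  moreover have "degree (smult (coeff p m) q) \<le> m"
    using \<open>degree q = m\<close> by (meson degree_smult_le order.trans order_refl)
  ultimately have "p = smult (coeff p m) q"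
    using root deg by (intro poly_eqI_degree_lead_coeff[of p m _ "\<eta> ` {..<m}"])
      (auto simp: q_def poly_prod)
  then have p: "poly p z = coeff p m * (\<Prod>j<m. z - \<eta> j)" for z
    by (metis (no_types, lifting) poly_smult poly_prod prod.cong q_def poly_pCons poly_0 mult_zero_right add_0_right
        mult_1_right diff_conv_add_uminus add.commute)
  have "0 < (\<Prod>j<m. 0 - \<eta> j)"
    using root by (intro prod_pos) auto
  then have K: "0 < coeff p m"
    using pos p[of 0] by (simp add: zero_less_mult_iff)
  have "(\<Prod>j<m. y - \<eta> j) = (\<Prod>j\<in>{..<i}. y - \<eta> j) * (\<Prod>j\<in>{i..<m}. y - \<eta> j)"
    using i by (subst prod.union_disjoint[symmetric]) (auto simp: ivl_disj_un)
  also have "(\<Prod>j\<in>{..<i}. y - \<eta> j) = (\<Prod>j\<in>{..<i}. - 1 * (\<eta> j - y))"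
    by (intro prod.cong) auto
  also have "\<dots> = (- 1) ^ i * (\<Prod>j\<in>{..<i}. \<eta> j - y)"
    by (subst prod.distrib) simp
  finally have "(- 1) ^ i * poly p y
      = coeff p m * (\<Prod>j\<in>{..<i}. \<eta> j - y) * (\<Prod>j\<in>{i..<m}. y - \<eta> j)"
    by (simp add: p power_mult_distrib[symmetric])
  moreover have "0 < (\<Prod>j\<in>{..<i}. \<eta> j - y)" "0 < (\<Prod>j\<in>{i..<m}. y - \<eta> j)"
    using left right by (auto intro!: prod_pos)
  ultimately show ?thesis
    using K by simp
qed

section \<open>Functions with a single sign change\<close>

definition single_sign_change :: "real \<Rightarrow> real \<Rightarrow> (real \<Rightarrow> real) \<Rightarrow> bool" where
  "single_sign_change a b f \<longleftrightarrow> (\<exists>\<beta> \<sigma>. \<sigma> \<noteq> 0 \<and> a \<le> \<beta> \<and> \<beta> \<le> b \<and>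
     (\<forall>t. a < t \<longrightarrow> t < \<beta> \<longrightarrow> \<sigma> * f t < 0) \<and> (\<forall>t. \<beta> < t \<longrightarrow> t < b \<longrightarrow> 0 < \<sigma> * f t))"

text \<open>\<open>f\<close> decreases up to \<beta> and increases afterwards, while its end values
  vanish together or have opposite signs. If both vanish, \<open>f\<close> is negative inside and
  the sign change is placed at \<open>b\<close>; otherwise there is one crossing, on the increasing
  branch if \<open>f b > 0\<close> and on the decreasing one if \<open>f b < 0\<close>.\<close>

lemma unimodal_single_sign_change:
  fixes f g :: "real \<Rightarrow> real"
  assumes der: "\<And>t. (f has_field_derivative g t) (at t)"
    and ends: "f a = k * f b" "k < 0"
    and \<beta>: "a < b" "a \<le> \<beta>" "\<beta> \<le> b"
    and neg: "\<And>t. a < t \<Longrightarrow> t < \<beta> \<Longrightarrow> g t < 0"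
    and pos: "\<And>t. \<beta> < t \<Longrightarrow> t < b \<Longrightarrow> 0 < g t"
  shows "single_sign_change a b f" and "f b = 0 \<Longrightarrow> a < t \<Longrightarrow> t < b \<Longrightarrow> f t < 0"
proof -
  have cont: "continuous_on S f" for S
    by (meson der DERIV_continuous continuous_at_imp_continuous_on)
  have dec: "f t < f s" if "a \<le> s" "s < t" "t \<le> \<beta>" for s t
    using that by (intro DERIV_neg_imp_decreasing_open[of s t f] cont)
      (use der neg in \<open>force+\<close>)
  have inc: "f s < f t" if "\<beta> \<le> s" "s < t" "t \<le> b" for s t
    using that by (intro DERIV_pos_imp_increasing_open[of s t f] cont)
      (use der pos in \<open>force+\<close>)
  have zero: "f t < 0" if "f b = 0" "a < t" "t < b" for t
    using that dec[of a t] inc[of t b] ends by (cases "t \<le> \<beta>") auto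
  show "f b = 0 \<Longrightarrow> a < t \<Longrightarrow> t < b \<Longrightarrow> f t < 0"
    using zero by blast
  consider "f b = 0" | "0 < f b" | "f b < 0"
    by linarith
  then show "single_sign_change a b f"
  proof cases
    case 1
    then show ?thesis
      unfolding single_sign_change_def using zero \<beta> by (intro exI[of _ b] exI[of _ 1]) auto
  next
    case 2
    then have "f a < 0"
      using ends by (simp add: mult_neg_pos)
    then have low: "f t < 0" if "a \<le> t" "t \<le> \<beta>" for t
      using that dec[of a t] by (cases "a = t") auto
    obtain \<zeta> where \<zeta>: "\<beta> \<le> \<zeta>" "\<zeta> \<le> b" "f \<zeta> = 0"
      using IVT'[of f \<beta> 0 b] low[of \<beta>] 2 \<beta> cont by auto
    have "f t < 0" if "a < t" "t < \<zeta>" for t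
      using that low[of t] inc[of t \<zeta>] \<zeta> by (cases "t \<le> \<beta>") auto
    moreover have "0 < f t" if "\<zeta> < t" "t < b" for t
      using that inc[of \<zeta> t] \<zeta> by auto
    ultimately show ?thesis
      unfolding single_sign_change_def using \<zeta> \<beta> by (intro exI[of _ \<zeta>] exI[of _ 1]) auto
  next
    case 3
    then have "0 < f a"
      using ends by (simp add: mult_neg_neg)
    have low: "f t < 0" if "\<beta> \<le> t" "t \<le> b" for t
      using that inc[of t b] 3 by (cases "t = b") auto
    obtain \<zeta> where \<zeta>: "a \<le> \<zeta>" "\<zeta> \<le> \<beta>" "f \<zeta> = 0"
      using IVT2'[of f \<beta> 0 a] low[of \<beta>] \<open>0 < f a\<close> \<beta> cont by auto
    have "0 < f t" if "a < t" "t < \<zeta>" for t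
      using that dec[of t \<zeta>] \<zeta> by auto
    moreover have "f t < 0" if "\<zeta> < t" "t < b" for t
      using that dec[of \<zeta> t] low[of t] \<zeta> by (cases "t \<le> \<beta>") auto
    ultimately show ?thesis
      unfolding single_sign_change_def using \<zeta> \<beta> by (intro exI[of _ \<zeta>] exI[of _ "- 1"]) auto
  qed
qed

text \<open>Multiplying by the orientation \<sigma> of \<open>g\<close> reduces to the
  decreasing-then-increasing case, and preserves the relation between the end values.\<close>

lemma single_sign_change_antiderivative:
  fixes f g :: "real \<Rightarrow> real"
  assumes g: "single_sign_change a b g"
    and der: "\<And>t. (f has_field_derivative c * g t) (at t)" "0 < c"
    and ends: "f a = k * f b" "k < 0" and "a < b"
  shows "single_sign_change a b f"
    and "f b = 0 \<Longrightarrow> (\<forall>t. a < t \<longrightarrow> t < b \<longrightarrow> f t < 0) \<or> (\<forall>t. a < t \<longrightarrow> t < b \<longrightarrow> 0 < f t)"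
proof -
  obtain \<beta> \<sigma> where \<beta>: "\<sigma> \<noteq> 0" "a \<le> \<beta>" "\<beta> \<le> b"
    and neg: "\<And>t. a < t \<Longrightarrow> t < \<beta> \<Longrightarrow> \<sigma> * g t < 0" and pos: "\<And>t. \<beta> < t \<Longrightarrow> t < b \<Longrightarrow> 0 < \<sigma> * g t"
    using g unfolding single_sign_change_def by auto
  have d: "((\<lambda>t. \<sigma> * f t) has_field_derivative \<sigma> * (c * g t)) (at t)" for t
    by (intro DERIV_cmult der)
  have e: "\<sigma> * f a = k * (\<sigma> * f b)"
    using ends by simp
  have n: "\<sigma> * (c * g t) < 0" if "a < t" "t < \<beta>" for t
    using neg[OF that] der(2) by (simp add: mult_less_0_iff zero_less_mult_iff)
  have p: "0 < \<sigma> * (c * g t)" if "\<beta> < t" "t < b" for t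
    using pos[OF that] der(2) by (simp add: mult_less_0_iff zero_less_mult_iff)
  note U = unimodal_single_sign_change[OF d e ends(2) \<open>a < b\<close> \<beta>(2,3) n p]
  from U(1) obtain \<beta>' \<sigma>' where *: "\<sigma>' \<noteq> 0" "a \<le> \<beta>'" "\<beta>' \<le> b"
    "\<forall>t. a < t \<longrightarrow> t < \<beta>' \<longrightarrow> \<sigma>' * (\<sigma> * f t) < 0" "\<forall>t. \<beta>' < t \<longrightarrow> t < b \<longrightarrow> 0 < \<sigma>' * (\<sigma> * f t)"
    unfolding single_sign_change_def by blast
  then show "single_sign_change a b f"
    unfolding single_sign_change_def using \<beta>(1)
    by (intro exI[of _ \<beta>'] exI[of _ "\<sigma>' * \<sigma>"]) (simp add: mult.assoc)
  assume "f b = 0"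
  then have "\<sigma> * f t < 0" if "a < t" "t < b" for t
    using U(2)[of t] that by simp
  then show "(\<forall>t. a < t \<longrightarrow> t < b \<longrightarrow> f t < 0) \<or> (\<forall>t. a < t \<longrightarrow> t < b \<longrightarrow> 0 < f t)"
    using \<beta>(1) by (cases "0 < \<sigma>") (auto simp: mult_less_0_iff)
qed

lemma exc_enum_single_sign_change:
  fixes x :: real
  assumes "x < 0" "n > 0"
  shows "single_sign_change x 1 (\<lambda>\<alpha>. exc_enum n \<alpha> x 1)"
  using assms(2)
proof (induction n rule: nat_induct_non_zero)
  case 1
  have "exc_enum 1 \<alpha> x 1 = \<alpha>" for \<alpha>
    by (simp add: exc_enum_Suc[of 0, simplified])
  then show ?case
    unfolding single_sign_change_def using assms by (intro exI[of _ 0] exI[of _ 1]) auto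
next
  case (Suc n)
  \<comment> \<open>By \<open>exc_enum_weak\<close> the value at \<alpha> = x is \<open>x\<close>
    times the value at \<alpha> = 1, so the ratio of the end values is \<open>x < 0\<close>.\<close>
  show ?case
    by (rule single_sign_change_antiderivative(1)[OF Suc.IH has_field_derivative_exc_enum_fixed])
      (use assms exc_enum_weak[of "Suc n" 1 x] in auto)
qed

text \<open>As a function of \<alpha> the enumerator vanishes at both ends of (x, 1), hence has
  constant sign inside. Its derivative at 1 is a positive multiple of
  \<open>exc_enum n 1 x 1\<close>, which fixes the sign just left of 1.\<close>

lemma exc_enum_constant_sign:
  fixes x :: real
  assumes "x < 0" "n > 0" and zero: "exc_enum (Suc n) 1 x 1 = 0"
    and s: "0 < s * exc_enum n 1 x 1" and t: "x < t" "t < 1"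
  shows "s * exc_enum (Suc n) t x 1 < 0"
proof -
  let ?f = "\<lambda>\<alpha>. exc_enum (Suc n) \<alpha> x 1"
  have const: "(\<forall>t. x < t \<longrightarrow> t < 1 \<longrightarrow> ?f t < 0) \<or> (\<forall>t. x < t \<longrightarrow> t < 1 \<longrightarrow> 0 < ?f t)"
    by (rule single_sign_change_antiderivative(2)[OF exc_enum_single_sign_change[OF assms(1,2)]
          has_field_derivative_exc_enum_fixed])
      (use assms exc_enum_weak[of "Suc n" 1 x] in auto)
  have "((\<lambda>\<alpha>. s * ?f \<alpha>) has_field_derivative s * (Suc n * exc_enum n 1 x 1)) (at 1)"
    by (intro DERIV_cmult has_field_derivative_exc_enum_fixed)
  moreover have "0 < s * (Suc n * exc_enum n 1 x 1)"
    using s mult_pos_pos[of "real (Suc n)" "s * exc_enum n 1 x 1"] by (simp add: mult.left_commute)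
  ultimately obtain d where d: "d > 0" "\<And>h. h > 0 \<Longrightarrow> h < d \<Longrightarrow> s * ?f (1 - h) < s * ?f 1"
    using DERIV_pos_inc_left by blast
  define h where "h = min (d / 2) ((1 - x) / 2)"
  have "h > 0" "h < d" "x < 1 - h" "1 - h < 1"
    using d(1) assms(1) by (auto simp: h_def min_def field_simps)
  then have neg: "s * ?f (1 - h) < 0" and h: "x < 1 - h" "1 - h < 1"
    using d(2)[of h] zero by simp_all
  from const show ?thesis
  proof
    assume "\<forall>t. x < t \<longrightarrow> t < 1 \<longrightarrow> ?f t < 0"
    then have "?f (1 - h) < 0" "?f t < 0"
      using h t by blast+
    then show ?thesis
      using neg by (simp add: mult_less_0_iff)
  next
    assume "\<forall>t. x < t \<longrightarrow> t < 1 \<longrightarrow> 0 < ?f t"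
    then have "0 < ?f (1 - h)" "0 < ?f t"
      using h t by blast+
    then show ?thesis
      using neg by (simp add: mult_less_0_iff)
  qed
qed

section \<open>Eulerian polynomials: degree, reciprocity and zeros\<close>

definition eulerian_poly :: "nat \<Rightarrow> real poly" where
  "eulerian_poly n = exc_enum n 1 [:0, 1:] 1"

lemma poly_eulerian_poly: "poly (eulerian_poly n) z = exc_enum n 1 z 1"
  by (simp add: eulerian_poly_def poly_exc_enum)

lemma exc_enum_unit_0: "exc_enum n 1 0 1 = 1"
  by (induction n) (auto simp: exc_enum_Suc)

text \<open>Position \<open>n\<close> is never an excedance, so at most n - 1 factors have degree
  1.\<close>

lemma degree_eulerian_poly: "degree (eulerian_poly n) \<le> n - 1"
proof -
  have "degree (\<Prod>i\<in>{1..n}. exc_weight 1 [:0, 1:] (1 :: real poly) i (\<pi> i)) \<le> n - 1"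
    if \<pi>: "\<pi> permutes {1..n}" for \<pi>
  proof -
    have "degree (\<Prod>i\<in>{1..n}. exc_weight 1 [:0, 1:] (1 :: real poly) i (\<pi> i))
        \<le> (\<Sum>i\<in>{1..n}. degree (exc_weight 1 [:0, 1:] (1 :: real poly) i (\<pi> i)))"
      by (metis (no_types, lifting) degree_prod_sum_le finite_atLeastAtMost comp_apply sum.cong)
    also have "\<dots> \<le> (\<Sum>i\<in>{1..n}. if i \<in> {1..<n} then 1 else 0)"
    proof (rule sum_mono)
      fix i assume "i \<in> {1..n}"
      then have "\<pi> i \<in> {1..n}"
        using permutes_in_image[OF \<pi>] by blast
      then show "degree (exc_weight 1 [:0, 1:] (1 :: real poly) i (\<pi> i)) \<le> (if i \<in> {1..<n} then 1 else 0)"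
        using \<open>i \<in> {1..n}\<close> by (auto simp: exc_weight_def)
    qed
    also have "\<dots> = (\<Sum>i\<in>{1..<n}. 1)"
      by (intro sum.mono_neutral_cong_right) auto
    finally show ?thesis
      by simp
  qed
  then show ?thesis
    unfolding eulerian_poly_def exc_enum_def by (intro degree_sum_le) (auto simp: finite_permutations)
qed

text \<open>Passing to weak excedances by \<open>exc_enum_weak\<close>, taking the factor
  \<open>z\<close> out of all weights and exchanging \<open>x\<close> and \<open>y\<close> reverses
  the polynomial.\<close>

lemma eulerian_reciprocal:
  fixes z :: real
  assumes "n > 0" "z \<noteq> 0"
  shows "exc_enum n 1 z 1 = z ^ (n - 1) * exc_enum n 1 (1 / z) 1"
proof -
  have "z * exc_enum n 1 z 1 = exc_enum n (z * 1) (z * 1) (z * (1 / z))"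
    using exc_enum_weak[of n 1 z] assms by simp
  also have "\<dots> = z ^ n * exc_enum n 1 (1 / z) 1"
    unfolding exc_enum_homogeneous by (simp only: exc_enum_commute[of n 1 1])
  also have "\<dots> = z * (z ^ (n - 1) * exc_enum n 1 (1 / z) 1)"
    using assms by (cases n) auto
  finally show ?thesis
    using assms by simp
qed

text \<open>Reciprocity transfers positivity near 0, where the value is 1, to the sign far to the
  left.\<close>

lemma eulerian_sign_at_minus_infinity:
  fixes B :: real
  assumes "n > 0"
  obtains N where "N < B" "N < 0" "0 < (- 1) ^ (n - 1) * exc_enum n 1 N 1"
proof -
  have "isCont (poly (eulerian_poly n)) 0" "0 < poly (eulerian_poly n) 0"
    by (auto simp: poly_eulerian_poly exc_enum_unit_0)
  then obtain d where d: "d > 0" "\<And>w. \<bar>w\<bar> < d \<Longrightarrow> 0 < poly (eulerian_poly n) w"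
    using LIM_fun_gt_zero[of "poly (eulerian_poly n)" "poly (eulerian_poly n) 0" 0]
    by (auto simp: isCont_def) (metis diff_zero poly_eulerian_poly exc_enum_unit_0 zero_less_one)
  define N where "N = - (1 / d + 1 + \<bar>B\<bar>)"
  have N: "N < B" "N < 0" "- N > 1 / d"
    using zero_less_divide_1_iff[of d] d(1) unfolding N_def by linarith+
  have "\<bar>1 / N\<bar> < d"
    using N d(1) by (auto simp: field_simps)
  then have "0 < exc_enum n 1 (1 / N) 1"
    using d(2) by (simp add: poly_eulerian_poly)
  moreover have "(- 1) ^ (n - 1) * exc_enum n 1 N 1 = (- N) ^ (n - 1) * exc_enum n 1 (1 / N) 1"
    using eulerian_reciprocal[OF assms, of N] N by (simp add: power_mult_distrib[symmetric] flip: mult.assoc)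
  moreover have "0 < (- N) ^ (n - 1)"
    using N by simp
  ultimately show ?thesis
    using that[OF N(1,2)] by simp
qed

text \<open>The zeros are listed downwards from the one closest to 0. The sign condition in
  \<open>t\<close> is carried through the induction because, up to a positive factor, it concerns
  the \<alpha>-derivative for size n + 1: it gives the signs of the next Eulerian polynomial at the
  old zeros, hence interlacing, and interlacing gives the sign condition at the new zeros.\<close>

lemma eulerian_zeros:
  assumes "n > 0"
  shows "\<exists>\<eta>::nat \<Rightarrow> real. (\<forall>i<n - 1. \<eta> i < 0 \<and> exc_enum n 1 (\<eta> i) 1 = 0 \<and>
      (\<forall>t. \<eta> i < t \<longrightarrow> t < 1 \<longrightarrow> (- 1) ^ i * exc_enum n t (\<eta> i) 1 < 0)) \<and>
    (\<forall>i. Suc i < n - 1 \<longrightarrow> \<eta> (Suc i) < \<eta> i)"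
  using assms
proof (induction n rule: nat_induct_non_zero)
  case 1
  show ?case
    by simp
next
  case (Suc n)
  then obtain \<eta> :: "nat \<Rightarrow> real" where \<eta>:
    "\<And>i. i < n - 1 \<Longrightarrow> \<eta> i < 0" "\<And>i. i < n - 1 \<Longrightarrow> exc_enum n 1 (\<eta> i) 1 = 0"
    "\<And>i t. i < n - 1 \<Longrightarrow> \<eta> i < t \<Longrightarrow> t < 1 \<Longrightarrow> (- 1) ^ i * exc_enum n t (\<eta> i) 1 < 0"
    "\<And>i. Suc i < n - 1 \<Longrightarrow> \<eta> (Suc i) < \<eta> i"
    by blast
  obtain N where N: "N < \<eta> (n - 2)" "N < 0" "0 < (- 1) ^ n * exc_enum (Suc n) 1 N 1"
    using eulerian_sign_at_minus_infinity[of "Suc n"] by auto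
  \<comment> \<open>Sample points for the next Eulerian polynomial: 0, the n - 1 old zeros and
    \<open>N\<close>, giving \<open>n\<close> sign changes.\<close>
  define x where "x i = (if i = 0 then 0 else if i < n then \<eta> (i - 1) else N)" for i
  have x_dec: "x (Suc i) < x i" if "i < n" for i
  proof (cases i)
    case 0
    then show ?thesis
      using \<eta>(1)[of 0] N that by (auto simp: x_def)
  next
    case (Suc j)
    show ?thesis
    proof (cases "Suc i < n")
      case False
      then have "n - 2 = j"
        using that Suc by simp
      then show ?thesis
        using N that Suc False by (simp add: x_def)
    qed (use \<eta>(4)[of j] Suc in \<open>auto simp: x_def\<close>)
  qed
  have x_alt: "0 < (- 1) ^ i * poly (eulerian_poly (Suc n)) (x i)" if le: "i \<le> n" for i
  proof -
    consider "i = 0" | "0 < i" "i < n" | "i = n" "n > 0"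
      using le \<open>n > 0\<close> by linarith
    then show ?thesis
    proof cases
      case i: 2
      obtain j where 2: "i = Suc j" "j < n - 1"
        using i by (cases i) auto
      let ?f = "\<lambda>\<alpha>. exc_enum (Suc n) \<alpha> (\<eta> j) 1"
      have der: "((\<lambda>\<alpha>. (- 1) ^ j * ?f \<alpha>) has_field_derivative
          (- 1) ^ j * (Suc n * exc_enum n t (\<eta> j) 1)) (at t)" for t
        by (intro DERIV_cmult has_field_derivative_exc_enum_fixed)
      \<comment> \<open>The signed function decreases from \<eta> j to 1, and its value at \<eta> j
        is the negative number \<eta> j times its value at 1; this forces the sign at 1.\<close>
      have "(- 1) ^ j * ?f 1 < (- 1) ^ j * ?f (\<eta> j)"
      proof (rule DERIV_neg_imp_decreasing_open[of "\<eta> j" 1])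
        show "\<exists>y. ((\<lambda>\<alpha>. (- 1) ^ j * ?f \<alpha>) has_field_derivative y) (at t) \<and> y < 0"
          if "\<eta> j < t" "t < 1" for t
        proof -
          have "real (Suc n) * ((- 1) ^ j * exc_enum n t (\<eta> j) 1) < 0"
            by (rule mult_pos_neg[OF _ \<eta>(3)[OF 2(2) that]]) simp
          then show ?thesis
            using der[of t] by (metis mult.left_commute)
        qed
        show "continuous_on {\<eta> j..1} (\<lambda>\<alpha>. (- 1) ^ j * ?f \<alpha>)"
          by (intro continuous_at_imp_continuous_on ballI DERIV_isCont[OF der])
      qed (use \<eta>(1)[OF 2(2)] in simp)
      also have "?f (\<eta> j) = \<eta> j * ?f 1"
        using exc_enum_weak[of "Suc n" 1 "\<eta> j"] by simp
      finally have "0 < (1 - \<eta> j) * ((- 1) ^ Suc j * ?f 1)"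
        by (simp add: algebra_simps)
      then have "0 < (- 1) ^ Suc j * ?f 1"
        by (rule zero_less_mult_pos) (use \<eta>(1)[OF 2(2)] in simp)
      then show ?thesis
        using 2(1) i by (simp add: x_def poly_eulerian_poly)
    qed (use N in \<open>auto simp: x_def poly_eulerian_poly exc_enum_unit_0\<close>)
  qed
  obtain \<rho> where \<rho>: "\<And>i. i < n \<Longrightarrow> x (Suc i) < \<rho> i \<and> \<rho> i < x i \<and> poly (eulerian_poly (Suc n)) (\<rho> i) = 0"
    using alternating_roots[OF x_dec x_alt] by metis
  have x_mono: "x j \<le> x i" if "i \<le> j" "j \<le> n" for i j
    using strict_dec_imp_less[of n x i j, OF x_dec] that by (cases "i = j") auto
  have \<eta>_x: "\<eta> j = x (Suc j)" if "j < n - 1" for j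
    using that by (auto simp: x_def)
  have \<rho>_neg: "\<rho> i < 0" if "i < n" for i
    using \<rho>[OF that] x_mono[of 0 i] that by (simp add: x_def)
  \<comment> \<open>Exactly the old zeros with index below \<open>i\<close> lie to the right of
    \<rho> i.\<close>
  have \<rho>_sign: "0 < (- 1) ^ i * exc_enum n 1 (\<rho> i) 1" if i: "i < n" for i
    unfolding poly_eulerian_poly[symmetric]
  proof (rule poly_sign_between_roots[where m = "n - 1" and \<eta> = \<eta>])
    show "inj_on \<eta> {..<n - 1}"
      using strict_dec_imp_less[of n x, OF x_dec] \<eta>_x
      by (intro linorder_inj_onI) (force simp: less_diff_conv)+
    show "\<eta> j < \<rho> i" if "i \<le> j" "j < n - 1" for j
    proof -
      have "Suc j \<le> n"
        using that by linarith
      then show ?thesis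
        using \<rho>[OF i] x_mono[of "Suc i" "Suc j"] that \<eta>_x[OF that(2)] by simp
    qed
    show "\<rho> i < \<eta> j" if "j < i" for j
      using \<rho>[OF i] x_mono[of "Suc j" i] that i by (simp add: \<eta>_x)
  qed (use \<eta> i degree_eulerian_poly in \<open>auto simp: poly_eulerian_poly exc_enum_unit_0\<close>)
  show ?case
  proof (intro exI[of _ \<rho>] conjI allI impI)
    fix i assume "i < Suc n - 1"
    then have i: "i < n"
      by simp
    show "\<rho> i < 0"
      using i by (rule \<rho>_neg)
    show zero: "exc_enum (Suc n) 1 (\<rho> i) 1 = 0"
      using \<rho>[OF i] by (simp add: poly_eulerian_poly)
    show "(- 1) ^ i * exc_enum (Suc n) t (\<rho> i) 1 < 0" if "\<rho> i < t" "t < 1" for t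
      using exc_enum_constant_sign[OF \<rho>_neg[OF i] \<open>n > 0\<close> zero \<rho>_sign[OF i] that] .
  next
    fix i assume "Suc i < Suc n - 1"
    then show "\<rho> (Suc i) < \<rho> i"
      using \<rho>[of i] \<rho>[of "Suc i"] by auto
  qed
qed

section \<open>The decomposition of the colored derangement polynomial\<close>

text \<open>Extends identities obtained on (0, 1), through reciprocals or power series, to all
  arguments.\<close>

lemma poly_eqI_open_interval:
  fixes p q :: "real poly"
  assumes "u < v" "\<And>z. u < z \<Longrightarrow> z < v \<Longrightarrow> poly p z = poly q z"
  shows "p = q"
proof (rule ccontr)
  assume "p \<noteq> q"
  then have "finite {z. poly (p - q) z = 0}"
    by (intro poly_roots_finite) simp
  moreover have "{u<..<v} \<subseteq> {z. poly (p - q) z = 0}"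
    using assms by auto
  ultimately show False
    using infinite_Ioo[OF \<open>u < v\<close>] finite_subset by blast
qed

lemma real_rooted_pCons_0:
  assumes "real_rooted p"
  shows "real_rooted (pCons 0 p)"
  using assms by (auto simp: real_rooted_def map_poly_pCons)

lemma exc_enum_no_exc: "exc_enum n \<alpha> 0 1 = \<alpha> ^ n"
  by (induction n) (auto simp: exc_enum_Suc)

text \<open>Both \<open>a\<close> and the local h-polynomial satisfy this equation. The zero of
  \<open>q\<close> at 0 is split off; the quotient has degree at most n - 1 and alternates along the
  n - 1 Eulerian zeros, since at such z < 0 the two enumerators have the same sign and the
  coefficient -z is positive.\<close>

lemma real_rooted_symmetric_part:
  fixes q :: "real poly"
  assumes n: "n > 0" and c: "0 \<le> c" "c < 1" and K: "K > 0" and deg: "degree q \<le> n"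
    and q: "\<And>z. (1 - z) * poly q z = K * (exc_enum n (c * z) z 1 - z * exc_enum n c z 1)"
  shows "real_rooted q"
proof (cases "n = 1")
  \<comment> \<open>For \<open>n = 1\<close> the enumerator is \<alpha> itself, so the right-hand
    side cancels and \<open>q\<close> vanishes.\<close>
  case True
  have "exc_enum 1 \<alpha> z (1::real) = \<alpha>" for \<alpha> z
    by (simp add: exc_enum_Suc[of 0, simplified])
  then have "poly ([:1, -1:] * q) z = 0" for z
    using q[of z] True by (simp add: algebra_simps)
  then have "[:1, -1:] * q = 0"
    using poly_all_0_iff_0 by blast
  then have "q = 0"
    by (simp only: mult_eq_0_iff) simp
  then show ?thesis
    by (simp add: real_rooted_def)
next
  case False
  obtain a p where ap: "q = pCons a p"
    by (cases q)
  have "a = 0"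
    using q[of 0] n ap by (simp add: exc_enum_no_exc)
  obtain \<eta> :: "nat \<Rightarrow> real" where \<eta>:
    "\<And>i. i < n - 1 \<Longrightarrow> \<eta> i < 0"
    "\<And>i t. i < n - 1 \<Longrightarrow> \<eta> i < t \<Longrightarrow> t < 1 \<Longrightarrow> (- 1) ^ i * exc_enum n t (\<eta> i) 1 < 0"
    "\<And>i. Suc i < n - 1 \<Longrightarrow> \<eta> (Suc i) < \<eta> i"
    using eulerian_zeros[OF n] by blast
  have "real_rooted p"
  proof (rule real_rooted_if_alternating[where m = "n - 2" and x = \<eta>])
    show "degree p \<le> Suc (n - 2)"
      using deg False ap by (auto split: if_splits)
    show "\<eta> (Suc i) < \<eta> i" if "i < n - 2" for i
      using \<eta>(3)[of i] that by auto
    show "0 < (- 1) ^ i * poly p (\<eta> i)" if "i \<le> n - 2" for i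
    proof -
      have i: "i < n - 1"
        using that False n by auto
      let ?s = "(- 1) ^ i :: real" and ?z = "\<eta> i"
      have z: "?z < 0"
        using \<eta>(1)[OF i] .
      have "?z < c * ?z"
        using z c mult_strict_right_mono_neg[of c 1 ?z] by simp
      moreover have "c * ?z \<le> 0"
        using z c by (simp add: mult_nonneg_nonpos)
      ultimately have D: "?s * exc_enum n (c * ?z) ?z 1 < 0"
        using \<eta>(2)[OF i, of "c * ?z"] by linarith
      have R: "?s * exc_enum n c ?z 1 < 0"
        using \<eta>(2)[OF i, of c] z c by linarith
      have "(1 - ?z) * (?s * poly q ?z) = K * (?s * exc_enum n (c * ?z) ?z 1 - ?z * (?s * exc_enum n c ?z 1))"
        using arg_cong[OF q[of ?z], of "(*) ?s"] by (simp add: algebra_simps)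
      moreover have "?s * exc_enum n (c * ?z) ?z 1 - ?z * (?s * exc_enum n c ?z 1) < 0"
        using D mult_neg_neg[OF z R] by linarith
      ultimately have "(1 - ?z) * (?s * poly q ?z) < 0"
        using K by (simp add: mult_pos_neg)
      then have "?s * poly q ?z < 0"
        using z by (simp add: mult_less_0_iff)
      then have "?z * (?s * poly p ?z) < 0"
        using ap \<open>a = 0\<close> by (simp add: algebra_simps)
      then show ?thesis
        using z by (auto simp: mult_less_0_iff[of ?z])
    qed
  qed
  then show ?thesis
    using ap \<open>a = 0\<close> real_rooted_pCons_0 by simp
qed

text \<open>The sample points are 0, where the value is \<open>K * c ^ n\<close>, and the zeros of
  the Eulerian polynomial of size n - 1. At such a zero z the enumerator of size \<open>n\<close> is
  strictly monotone in \<alpha> on (z, 1), which contains both cz and c, and this signs the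
  difference. For \<open>c = 0\<close> the difference vanishes identically.\<close>

lemma real_rooted_complementary_part:
  fixes q :: "real poly"
  assumes n: "n > 0" and c: "0 \<le> c" "c < 1" and K: "K > 0" and deg: "degree q \<le> n - 1"
    and q: "\<And>z. (z - 1) * poly q z = K * (exc_enum n (c * z) z 1 - exc_enum n c z 1)"
  shows "real_rooted q"
proof (cases "c = 0")
  case True
  then have "poly ([:-1, 1:] * q) z = 0" for z
    using q[of z] by (simp add: algebra_simps)
  then have "[:-1, 1:] * q = 0"
    using poly_all_0_iff_0 by blast
  then have "q = 0"
    by (simp only: mult_eq_0_iff) simp
  then show ?thesis
    by (simp add: real_rooted_def)
next
  case False
  then have "c > 0"
    using c by simp
  obtain \<eta> :: "nat \<Rightarrow> real" where \<eta>:
    "\<And>i. i < n - 2 \<Longrightarrow> \<eta> i < 0"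
    "\<And>i t. i < n - 2 \<Longrightarrow> \<eta> i < t \<Longrightarrow> t < 1 \<Longrightarrow> (- 1) ^ i * exc_enum (n - 1) t (\<eta> i) 1 < 0"
    "\<And>i. Suc i < n - 2 \<Longrightarrow> \<eta> (Suc i) < \<eta> i"
  proof (cases "n = 1")
    case False
    then show ?thesis
      using eulerian_zeros[of "n - 1"] n that by (auto simp: numeral_2_eq_2)
  qed (use that in auto)
  define x where "x i = (if i = 0 then 0 else \<eta> (i - 1))" for i
  show ?thesis
  proof (rule real_rooted_if_alternating[where m = "n - 2" and x = x])
    show "degree q \<le> Suc (n - 2)"
      using deg by linarith
    show "x (Suc i) < x i" if "i < n - 2" for i
      using \<eta>(1)[of i] \<eta>(3)[of "i - 1"] that by (cases i) (auto simp: x_def)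
    show "0 < (- 1) ^ i * poly q (x i)" if "i \<le> n - 2" for i
    proof (cases i)
      case 0
      have "poly q 0 = K * c ^ n"
        using q[of 0] n by (simp add: exc_enum_no_exc zero_power)
      then show ?thesis
        using 0 K \<open>c > 0\<close> by (simp add: x_def)
    next
      case (Suc j)
      then have j: "j < n - 2"
        using that by simp
      let ?z = "\<eta> j" and ?s = "(- 1) ^ j :: real"
      let ?f = "\<lambda>\<alpha>. exc_enum n \<alpha> ?z 1"
      have z: "?z < 0"
        using \<eta>(1)[OF j] .
      have "((\<lambda>\<alpha>. ?s * ?f \<alpha>) has_field_derivative ?s * (n * exc_enum (n - 1) t ?z 1)) (at t)" for t
        using has_field_derivative_exc_enum_fixed[of "n - 1" ?z 1 t] n by (intro DERIV_cmult) simp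
      moreover have "?s * (n * exc_enum (n - 1) t ?z 1) < 0" if "?z < t" "t < 1" for t
        using mult_pos_neg[of "real n", OF _ \<eta>(2)[OF j that]] n by (simp add: mult.left_commute)
      moreover have "?z < c * ?z"
        using z c mult_strict_right_mono_neg[of c 1 ?z] by simp
      moreover have "c * ?z < 0"
        using z \<open>c > 0\<close> by (simp add: mult_pos_neg)
      ultimately have less: "?s * ?f c < ?s * ?f (c * ?z)"
        using \<open>c > 0\<close> c
        by (intro DERIV_neg_imp_decreasing[of "c * ?z" c "\<lambda>\<alpha>. ?s * ?f \<alpha>"]) (force intro: less_le_trans le_less_trans)+
      have "(?z - 1) * (?s * poly q ?z) = K * (?s * ?f (c * ?z) - ?s * ?f c)"
        using arg_cong[OF q[of ?z], of "(*) ?s"] by (simp add: algebra_simps)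
      then have "(?z - 1) * (?s * poly q ?z) > 0"
        using less K by simp
      then have "?s * poly q ?z < 0"
        using z by (simp add: zero_less_mult_iff)
      then show ?thesis
        using Suc by (simp add: x_def)
    qed
  qed
qed

text \<open>Given the permutation, colors are chosen independently at each position. A fixed point
  has r - 1 admissible colors, each making it an excedance; every other position admits all
  \<open>r\<close> colors.\<close>

lemma poly_colored_derangement_poly:
  assumes "r > 0"
  shows "poly (colored_derangement_poly n r) z = exc_enum n ((real r - 1) * z) (real r * z) (real r)"
proof -
  define B where "B \<pi> i = (if \<pi> i = i then {1..<r} else {0..<r})" for \<pi> :: "nat \<Rightarrow> nat" and i
  have Sig: "colored_derangements n r = Sigma {\<pi>. \<pi> permutes {1..n}} (\<lambda>\<pi>. PiE {1..n} (B \<pi>))"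
    unfolding colored_derangements_def B_def
    by (auto simp: PiE_iff extensional_def Suc_le_eq split: if_splits)
  define f where "f \<pi> i k = (if \<pi> i > i \<or> (\<pi> i = i \<and> k > 0) then z else 1)"
    for \<pi> :: "nat \<Rightarrow> nat" and i k :: nat
  have pow: "z ^ cexc n (\<pi>, c) = (\<Prod>i\<in>{1..n}. f \<pi> i (c i))" for \<pi> c
    unfolding cexc_def f_def by (simp add: prod.If_cases Int_def)
  have weight: "(\<Sum>k\<in>B \<pi> i. f \<pi> i k) = exc_weight ((real r - 1) * z) (real r * z) (real r) i (\<pi> i)" for \<pi> i
  proof -
    have "(\<Sum>k\<in>{1..<r}. if k > 0 then z else 1) = (\<Sum>k\<in>{1..<r}. z)"
      by (intro sum.cong) auto
    then show ?thesis
      using assms by (auto simp: B_def f_def exc_weight_def of_nat_diff)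
  qed
  have "poly (colored_derangement_poly n r) z = (\<Sum>\<sigma>\<in>colored_derangements n r. z ^ cexc n \<sigma>)"
    by (simp add: colored_derangement_poly_def poly_sum poly_monom)
  also have "\<dots> = (\<Sum>\<pi> | \<pi> permutes {1..n}. \<Sum>c\<in>PiE {1..n} (B \<pi>). z ^ cexc n (\<pi>, c))"
    unfolding Sig by (subst sum.Sigma) (auto simp: finite_permutations B_def intro!: finite_PiE)
  also have "\<dots> = (\<Sum>\<pi> | \<pi> permutes {1..n}. \<Prod>i\<in>{1..n}. \<Sum>k\<in>B \<pi> i. f \<pi> i k)"
    unfolding pow by (subst prod_sum_PiE) (auto simp: B_def)
  also have "\<dots> = exc_enum n ((real r - 1) * z) (real r * z) (real r)"
    unfolding weight exc_enum_def ..
  finally show ?thesis .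
qed

lemma symmetric_wrt_reciprocal:
  assumes "symmetric_wrt m p" "z \<noteq> 0"
  shows "z ^ m * poly p (1 / z) = poly p z"
proof -
  have p: "poly p w = (\<Sum>i\<le>m. coeff p i * w ^ i)" for w
    unfolding poly_altdef using assms(1)
    by (intro sum.mono_neutral_left) (auto simp: symmetric_wrt_def coeff_eq_0)
  have "z ^ m * (coeff p i * (1 / z) ^ i) = coeff p i * z ^ (m - i)" if "i \<le> m" for i
    using that assms(2) by (simp add: power_diff power_one_over)
  then have "z ^ m * poly p (1 / z) = (\<Sum>i\<le>m. coeff p i * z ^ (m - i))"
    unfolding p sum_distrib_left by (intro sum.cong) simp_all
  also have "\<dots> = (\<Sum>i\<le>m. coeff p (m - i) * z ^ (m - i))"
    using assms(1) unfolding symmetric_wrt_def by (intro sum.cong refl) (metis atMost_iff)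
  also have "\<dots> = (\<Sum>i\<le>m. coeff p i * z ^ i)"
    by (rule sum.reindex_bij_witness[of _ "\<lambda>i. m - i" "\<lambda>i. m - i"]) auto
  finally show ?thesis
    by (simp add: p)
qed

lemma colored_exc_enum_normalize:
  assumes "r > 0"
  shows "exc_enum n ((real r - 1) * w) (real r * z) (real r) = real r ^ n * exc_enum n ((real r - 1) / real r * w) z 1"
  using exc_enum_homogeneous[of n "real r" "(real r - 1) / real r * w" z 1] assms by simp

lemma In_decomposition_real_rooted:
  assumes n: "n > 0" and r: "r > 0" and ab: "In_decomposition n (colored_derangement_poly n r) a b"
  shows "real_rooted a" and "real_rooted b"
proof -
  define c where "c = (real r - 1) / real r"
  have c: "0 \<le> c" "c < 1"
    using r by (auto simp: c_def)
  have K: "0 < real r ^ n"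
    using r by simp
  let ?p = "colored_derangement_poly n r"
  have sum: "?p = a + [:0, 1:] * b" and sym: "symmetric_wrt n a" "symmetric_wrt (n - 1) b"
    using ab by (auto simp: In_decomposition_def)
  have D: "poly a z + z * poly b z = real r ^ n * exc_enum n (c * z) z 1" for z
    using poly_colored_derangement_poly[OF r, of n z] colored_exc_enum_normalize[OF r, of n z z] sum
    by (simp add: c_def)
  \<comment> \<open>a + b is the reversal of the derangement polynomial: with respect to
    \<open>n\<close>, \<open>a\<close> is its own reversal and the reversal of zb is
    \<open>b\<close>.\<close>
  have R': "poly a z + poly b z = real r ^ n * exc_enum n c z 1" if "0 < z" for z
  proof -
    have "z ^ n * (1 / z * poly b (1 / z)) = poly b z"
      using symmetric_wrt_reciprocal[OF sym(2), of z] that n by (cases n) auto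
    then have "poly a z + poly b z = z ^ n * (poly a (1 / z) + 1 / z * poly b (1 / z))"
      using symmetric_wrt_reciprocal[OF sym(1), of z] that by (simp add: distrib_left)
    also have "\<dots> = real r ^ n * (z ^ n * exc_enum n (c * (1 / z)) (1 / z) 1)"
      by (simp only: D mult.left_commute)
    also have "z ^ n * exc_enum n (c * (1 / z)) (1 / z) 1 = exc_enum n c z 1"
      using that by (subst exc_enum_homogeneous[symmetric]) (simp add: exc_enum_commute[of n c 1])
    finally show ?thesis .
  qed
  have "a + b = smult (real r ^ n) (exc_enum n [:c:] [:0, 1:] 1)"
    by (rule poly_eqI_open_interval[of 0 1]) (simp_all add: R' poly_exc_enum)
  then have R: "poly a z + poly b z = real r ^ n * exc_enum n c z 1" for z
    by (simp add: poly_exc_enum flip: poly_add)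
  \<comment> \<open>Eliminating \<open>b\<close>, and then \<open>a\<close>, from \<open>D\<close>
    and \<open>R\<close> gives the equations required by the two criteria.\<close>
  show "real_rooted a"
  proof (rule real_rooted_symmetric_part[OF n c K])
    show "(1 - z) * poly a z = real r ^ n * (exc_enum n (c * z) z 1 - z * exc_enum n c z 1)" for z
      using D[of z] arg_cong[OF R[of z], of "(*) z"] by (simp add: algebra_simps)
  qed (use sym in \<open>auto simp: symmetric_wrt_def\<close>)
  show "real_rooted b"
  proof (rule real_rooted_complementary_part[OF n c K])
    show "(z - 1) * poly b z = real r ^ n * (exc_enum n (c * z) z 1 - exc_enum n c z 1)" for z
      using D[of z] R[of z] by (simp add: algebra_simps)
  qed (use sym in \<open>auto simp: symmetric_wrt_def\<close>)
qed

section \<open>Faces of the edgewise subdivision\<close>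

definition esd_points :: "nat \<Rightarrow> nat set \<Rightarrow> (nat set \<Rightarrow> nat) set" where
  "esd_points r G = {x. (\<forall>S. x S \<noteq> 0 \<longrightarrow> S \<noteq> {} \<and> S \<subseteq> G) \<and>
     (\<forall>S T. x S \<noteq> 0 \<longrightarrow> x T \<noteq> 0 \<longrightarrow> S \<subseteq> T \<or> T \<subseteq> S) \<and> (\<Sum>S\<in>Pow G. x S) = r}"

text \<open>A vertex is a multichain \<open>S\<^sub>1 \<subseteq> \<dots> \<subseteq> S\<^sub>r\<close> of nonempty subsets of \<open>G\<close>; it is encoded by the
  function counting, for each \<open>e\<close>, the members that do not contain \<open>e\<close>. That \<open>S\<^sub>1\<close> is nonempty means
  that this function has a zero. In these coordinates the maps \<open>\<phi>\<close> of all chains are evaluations,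
  so faces become sets of functions with pairwise differences in \<open>{0, 1}\<close>.\<close>

definition heights :: "nat \<Rightarrow> 'a set \<Rightarrow> ('a \<Rightarrow> nat) set" where
  "heights r G = {g \<in> G \<rightarrow>\<^sub>E {0..r}. \<exists>e\<in>G. g e = 0}"

definition height_of :: "'a set \<Rightarrow> ('a set \<Rightarrow> nat) \<Rightarrow> 'a \<Rightarrow> nat" where
  "height_of G x = (\<lambda>e\<in>G. \<Sum>S | S \<in> Pow G \<and> e \<notin> S. x S)"

text \<open>The sublevel sets of \<open>g\<close> at 0, ..., r - 1 are the members of the multichain
  in increasing order.\<close>

definition of_height :: "nat \<Rightarrow> 'a set \<Rightarrow> ('a \<Rightarrow> nat) \<Rightarrow> 'a set \<Rightarrow> nat" where
  "of_height r G g S = card {j. j < r \<and> {e\<in>G. g e \<le> j} = S}"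

definition unit_step :: "'a set \<Rightarrow> ('a \<Rightarrow> nat) \<Rightarrow> ('a \<Rightarrow> nat) \<Rightarrow> bool" where
  "unit_step G g h \<longleftrightarrow> (\<forall>e\<in>G. g e = h e \<or> g e = Suc (h e))"

lemma unit_stepD: "unit_step G g h \<Longrightarrow> e \<in> G \<Longrightarrow> h e \<le> g e \<and> g e \<le> Suc (h e)"
  by (auto simp: unit_step_def)

lemma sum_nat_le_if_support_subset:
  fixes x :: "'a \<Rightarrow> nat"
  assumes "finite A" "finite B" "\<And>S. S \<in> A \<Longrightarrow> x S \<noteq> 0 \<Longrightarrow> S \<in> B"
  shows "sum x A \<le> sum x B"
proof -
  have "sum x A = sum x {S\<in>A. x S \<noteq> 0}"
    using assms by (intro sum.mono_neutral_right) auto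
  also have "\<dots> \<le> sum x B"
    using assms by (intro sum_mono2) auto
  finally show ?thesis .
qed

lemma sum_nat_eq_if_support_eq:
  fixes x :: "'a \<Rightarrow> nat"
  assumes "finite A" "finite B" "\<And>S. x S \<noteq> 0 \<Longrightarrow> S \<in> A \<longleftrightarrow> S \<in> B"
  shows "sum x A = sum x B"
  using assms by (intro antisym sum_nat_le_if_support_subset) auto

lemma esd_points_eq:
  assumes "G \<subseteq> {1..n}"
  shows "{x \<in> esd_vertices n r. \<forall>S. x S \<noteq> 0 \<longrightarrow> S \<subseteq> G} = esd_points r G"
proof (rule set_eqI)
  fix x
  show "x \<in> {x \<in> esd_vertices n r. \<forall>S. x S \<noteq> 0 \<longrightarrow> S \<subseteq> G} \<longleftrightarrow> x \<in> esd_points r G"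
  proof (cases "\<forall>S. x S \<noteq> 0 \<longrightarrow> S \<subseteq> G")
    case True
    have "(\<Sum>S\<in>Pow {1..n}. x S) = (\<Sum>S\<in>Pow G. x S)"
      using True assms finite_subset[OF assms] by (intro sum_nat_eq_if_support_eq) auto
    then show ?thesis
      unfolding esd_vertices_def esd_points_def mem_Collect_eq using True assms by (simp only:) blast
  next
    case False
    then show ?thesis
      unfolding esd_points_def by blast
  qed
qed

section \<open>Vertices as height functions, and the face condition in these terms\<close>

context
  fixes r :: nat and G :: "nat set"
  assumes fin: "finite G" and r: "r > 0"
begin

text \<open>The support is a finite nonempty chain, so it has a least member; this is a nonempty
  set, and its elements have height 0.\<close>

lemma height_of_in_heights:
  assumes x: "x \<in> esd_points r G"
  shows "height_of G x \<in> heights r G"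
proof -
  let ?supp = "{S. x S \<noteq> 0}"
  have supp: "?supp \<subseteq> Pow G" and tot: "(\<Sum>S\<in>Pow G. x S) = r"
    using x by (auto simp: esd_points_def)
  have "?supp \<noteq> {}"
    using tot r by (metis (mono_tags, lifting) empty_Collect_eq sum.neutral less_irrefl)
  moreover have "finite ?supp"
    using supp fin by (simp add: finite_subset)
  moreover have "subset.chain UNIV ?supp"
    using x by (auto simp: esd_points_def subset_chain_def)
  ultimately have "\<Inter>?supp \<in> ?supp"
    by (intro Inter_in_chain)
  then have "\<Inter>?supp \<noteq> {}" "\<Inter>?supp \<subseteq> G"
    using x by (auto simp: esd_points_def)
  then obtain e where e: "e \<in> \<Inter>?supp" "e \<in> G"
    by blast
  have "height_of G x e = 0"
    using e by (auto simp: height_of_def intro!: sum.neutral)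
  moreover have "height_of G x e \<le> r" if "e \<in> G" for e
    using that fin tot sum_nat_le_if_support_subset[of "{S. S \<in> Pow G \<and> e \<notin> S}" "Pow G" x]
    by (simp add: height_of_def)
  ultimately show ?thesis
    using e by (auto simp: heights_def height_of_def)
qed

lemma sum_of_height: "(\<Sum>S\<in>Pow G. of_height r G g S) = r"
proof -
  have "(\<Sum>S\<in>Pow G. of_height r G g S) = (\<Sum>S\<in>Pow G. \<Sum>j | j \<in> {..<r} \<and> {e\<in>G. g e \<le> j} = S. 1)"
    by (simp add: of_height_def)
  also have "\<dots> = (\<Sum>j<r. 1)"
    using fin by (intro sum.group) auto
  finally show ?thesis
    by simp
qed

lemma of_height_in_points:
  assumes g: "g \<in> heights r G"
  shows "of_height r G g \<in> esd_points r G"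
proof -
  have level: "\<exists>j<r. {e\<in>G. g e \<le> j} = S" if "of_height r G g S \<noteq> 0" for S
  proof -
    have "{j. j < r \<and> {e\<in>G. g e \<le> j} = S} \<noteq> {}"
      using that unfolding of_height_def by (metis card.empty)
    then show ?thesis
      by blast
  qed
  obtain e0 where "e0 \<in> G" "g e0 = 0"
    using g by (auto simp: heights_def)
  then have "S \<noteq> {} \<and> S \<subseteq> G" if "of_height r G g S \<noteq> 0" for S
    using level[OF that] by force
  moreover have "S \<subseteq> T \<or> T \<subseteq> S" if ST: "of_height r G g S \<noteq> 0" "of_height r G g T \<noteq> 0" for S T
  proof -
    obtain j k where "{e\<in>G. g e \<le> j} = S" "{e\<in>G. g e \<le> k} = T"
      using level ST by blast
    then show ?thesis
      by (cases "j \<le> k") auto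
  qed
  ultimately show ?thesis
    unfolding esd_points_def using sum_of_height by blast
qed

text \<open>An element \<open>e\<close> of \<open>G\<close> is missing from the sublevel set at
  \<open>j\<close> exactly when \<open>j < g e\<close>, and all these levels are below
  \<open>r\<close>.\<close>

lemma height_of_of_height:
  assumes g: "g \<in> heights r G"
  shows "height_of G (of_height r G g) = g"
proof
  fix e
  show "height_of G (of_height r G g) e = g e"
  proof (cases "e \<in> G")
    case True
    then have ge: "g e \<le> r"
      using g by (auto simp: heights_def)
    have "height_of G (of_height r G g) e
        = (\<Sum>S | S \<in> Pow G \<and> e \<notin> S. \<Sum>j | j \<in> {j. j < r \<and> e \<notin> {e\<in>G. g e \<le> j}} \<and> {e\<in>G. g e \<le> j} = S. 1)"
      using True unfolding height_of_def of_height_def restrict_apply'[OF True]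
      by (intro sum.cong refl) (auto intro!: arg_cong[where f = card])
    also have "\<dots> = (\<Sum>j | j < r \<and> e \<notin> {e\<in>G. g e \<le> j}. 1)"
      using fin by (intro sum.group) auto
    also have "{j. j < r \<and> e \<notin> {e\<in>G. g e \<le> j}} = {..<g e}"
      using True ge by auto
    finally show ?thesis
      by simp
  next
    case False
    then show ?thesis
      using g by (auto simp: height_of_def heights_def PiE_def extensional_def)
  qed
qed

text \<open>If \<open>a\<close> is the total multiplicity of the sets strictly below a set S of the
  support, every level from \<open>a\<close> to \<open>a + x S - 1\<close> has sublevel set S. So
  the reconstructed multiplicities are at least the original ones, and equal totals \<open>r\<close>
  force equality.\<close>

lemma of_height_height_of:
  assumes x: "x \<in> esd_points r G"
  shows "of_height r G (height_of G x) = x"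
proof
  fix S
  let ?g = "height_of G x"
  have chain: "S \<subseteq> T \<or> T \<subseteq> S" if "x S \<noteq> 0" "x T \<noteq> 0" for S T
    using x that by (auto simp: esd_points_def)
  have supp: "S \<subseteq> G" if "x S \<noteq> 0" for S
    using x that by (auto simp: esd_points_def)
  have tot: "(\<Sum>S\<in>Pow G. x S) = r"
    using x by (auto simp: esd_points_def)
  show "of_height r G ?g S = x S"
  proof (cases "S \<in> Pow G")
    case True
    have le: "x S \<le> of_height r G ?g S" if S: "S \<in> Pow G" for S
    proof (cases "x S = 0")
      case False
      let ?below = "{T. T \<in> Pow G \<and> T \<subset> S}"
      define a where "a = sum x ?below"
      have ins: "a + x S = sum x (insert S ?below)"
        using fin by (simp add: a_def)
      have "{a..<a + x S} \<subseteq> {j. j < r \<and> {e\<in>G. ?g e \<le> j} = S}"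
      proof
        fix j assume j: "j \<in> {a..<a + x S}"
        have "a + x S \<le> r"
          unfolding ins tot[symmetric] using S fin by (intro sum_nat_le_if_support_subset) auto
        moreover have "?g e \<le> j" if "e \<in> S" for e
        proof -
          have "?g e \<le> a"
            unfolding a_def height_of_def using that S fin chain[OF False]
            by (auto intro!: sum_nat_le_if_support_subset)
          then show ?thesis
            using j by simp
        qed
        moreover have "j < ?g e" if "e \<in> G" "e \<notin> S" for e
        proof -
          have "a + x S \<le> ?g e"
            unfolding ins height_of_def using that S fin
            by (auto intro!: sum_nat_le_if_support_subset simp del: sum.insert)
          then show ?thesis
            using j by simp
        qed
        ultimately show "j \<in> {j. j < r \<and> {e\<in>G. ?g e \<le> j} = S}"
          using j S by (force simp: not_le[symmetric])
      qed
      then have "card {a..<a + x S} \<le> card {j. j < r \<and> {e\<in>G. ?g e \<le> j} = S}"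
        by (intro card_mono) auto
      then show ?thesis
        by (simp add: of_height_def)
    qed simp
    show ?thesis
      using sum_mono_inv[of x "Pow G" "of_height r G ?g" S] le True fin tot sum_of_height[of ?g] by simp
  next
    case False
    then have "{j. j < r \<and> {e\<in>G. ?g e \<le> j} = S} = {}"
      by auto
    moreover have "x S = 0"
      using False supp by blast
    ultimately show ?thesis
      by (simp add: of_height_def)
  qed
qed

lemma height_of_eq_sum:
  assumes x: "x \<in> esd_points r G" and C: "finite C" "\<And>S. x S \<noteq> 0 \<Longrightarrow> S \<in> C" and e: "e \<in> G"
  shows "height_of G x e = (\<Sum>S | S \<in> C \<and> e \<notin> S. x S)"
  unfolding height_of_def restrict_apply'[OF e]
  using x C fin by (intro sum_nat_eq_if_support_eq) (auto simp: esd_points_def)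

text \<open>A set of the support that misses \<open>e\<close> cannot contain \<open>S\<close>, so it
  lies inside \<open>S\<close> and misses \<open>e'\<close> as well; \<open>S\<close> itself is
  counted only for \<open>e'\<close>.\<close>

lemma height_of_less:
  assumes x: "x \<in> esd_points r G" and S: "x S \<noteq> 0" and e: "e \<in> S" and e': "e' \<in> G" "e' \<notin> S"
  shows "height_of G x e < height_of G x e'"
proof -
  have chain: "S \<subseteq> T \<or> T \<subseteq> S" if "x T \<noteq> 0" for T
    using x S that by (auto simp: esd_points_def)
  have SG: "S \<subseteq> G"
    using x S by (auto simp: esd_points_def)
  have "height_of G x e < x S + height_of G x e"
    using S by simp
  also have "\<dots> = sum x (insert S {T. T \<in> Pow G \<and> e \<notin> T})"
    using e SG fin by (subst sum.insert) (auto simp: height_of_def)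
  also have "\<dots> \<le> height_of G x e'"
    using e e' SG fin chain unfolding height_of_def restrict_apply'[OF e'(1)]
    by (intro sum_nat_le_if_support_subset) auto
  finally show ?thesis .
qed

text \<open>Both \<phi> and the heights add multiplicities over an initial segment of a chain: the
  sets inside T, or the sets missing e. These are the same segments, apart from the empty and the
  full one, where the sums are constantly 0 and \<open>r\<close>.\<close>

lemma face_iff_unit_step:
  assumes F: "F \<subseteq> esd_points r G" "finite F" and G: "G \<subseteq> {1..n}"
  shows "F \<in> esd_faces n r \<longleftrightarrow> (\<forall>x\<in>F. \<forall>y\<in>F. unit_step G (height_of G x) (height_of G y) \<or>
      unit_step G (height_of G y) (height_of G x))"
    (is "?face \<longleftrightarrow> ?steps")
proof
  assume ?face
  then obtain C where C: "is_bchain n C" "\<forall>x\<in>F. \<forall>S. x S \<noteq> 0 \<longrightarrow> S \<in> C"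
    and phi: "\<forall>x\<in>F. \<forall>y\<in>F. (\<forall>T\<in>C. esd_phi C x T - esd_phi C y T \<in> {0, 1}) \<or>
                        (\<forall>T\<in>C. esd_phi C y T - esd_phi C x T \<in> {0, 1})"
    unfolding esd_faces_def mem_Collect_eq by (elim conjE exE) (rule that; assumption)
  have finC: "finite C"
    using C(1) by (meson finite_Diff finite_Pow_iff finite_atLeastAtMost finite_subset is_bchain_def)
  have rep: "(\<forall>x\<in>F. height_of G x e = 0) \<or> (\<exists>T\<in>C. \<forall>x\<in>F. int (height_of G x e) = esd_phi C x T)"
    if e: "e \<in> G" for e
  proof (cases "{S\<in>C. e \<notin> S} = {}")
    case True
    then have "height_of G x e = 0" if "x \<in> F" for x
      using height_of_eq_sum[of x C e] that F C(2) finC e by (auto simp: subset_iff)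
    then show ?thesis
      by blast
  next
    case False
    \<comment> \<open>The sets of the chain that miss \<open>e\<close> are those contained in the
      largest of them.\<close>
    define T where "T = \<Union>{S\<in>C. e \<notin> S}"
    have "subset.chain UNIV {S\<in>C. e \<notin> S}"
      using C(1) by (auto simp: is_bchain_def subset_chain_def)
    then have T: "T \<in> {S\<in>C. e \<notin> S}"
      unfolding T_def using False finC by (intro Union_in_chain) auto
    then have "{S\<in>C. e \<notin> S} = {S\<in>C. S \<subseteq> T}"
      unfolding T_def by blast
    then have "int (height_of G x e) = esd_phi C x T" if "x \<in> F" for x
      using height_of_eq_sum[of x C e] that F C(2) finC e by (auto simp: subset_iff esd_phi_def)
    then show ?thesis
      using T by blast
  qed
  have step: "unit_step G (height_of G x) (height_of G y)"
    if xy: "x \<in> F" "y \<in> F" "\<forall>T\<in>C. esd_phi C x T - esd_phi C y T \<in> {0, 1}" for x y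
    unfolding unit_step_def
  proof
    fix e assume "e \<in> G"
    from rep[OF this] show "height_of G x e = height_of G y e \<or> height_of G x e = Suc (height_of G y e)"
    proof
      assume "\<exists>T\<in>C. \<forall>x\<in>F. int (height_of G x e) = esd_phi C x T"
      then obtain T where T: "T \<in> C" "\<forall>x\<in>F. int (height_of G x e) = esd_phi C x T"
        by blast
      have "int (height_of G x e) - int (height_of G y e) = esd_phi C x T - esd_phi C y T"
        using xy(1,2) T(2) by simp
      also have "\<dots> \<in> {0, 1}"
        using xy(3) T(1) by blast
      finally have "int (height_of G x e) - int (height_of G y e) \<in> {0, 1}" .
      then show ?thesis
        by auto
    qed (use xy in auto)
  qed
  show ?steps
  proof (intro ballI)
    fix x y assume xy: "x \<in> F" "y \<in> F"
    show "unit_step G (height_of G x) (height_of G y) \<or> unit_step G (height_of G y) (height_of G x)"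
      using phi[rule_format, OF xy] step[OF xy] step[OF xy(2,1)] by argo
  qed
next
  assume steps: ?steps
  \<comment> \<open>The least candidate for a common chain: all sets that occur in some vertex of
    \<open>F\<close>.\<close>
  define C where "C = {S. \<exists>x\<in>F. x S \<noteq> 0}"
  have supp: "S \<in> C" if "x \<in> F" "x S \<noteq> 0" for x S
    unfolding C_def using that by blast
  have CG: "S \<subseteq> G" "S \<noteq> {}" if SC: "S \<in> C" for S
  proof -
    obtain x where "x \<in> F" "x S \<noteq> 0"
      using SC by (auto simp: C_def)
    then have "x \<in> esd_points r G" "x S \<noteq> 0"
      using F(1) by auto
    then show "S \<subseteq> G" "S \<noteq> {}"
      by (auto simp: esd_points_def)
  qed
  then have finC: "finite C"
    using fin by (meson Pow_iff finite_Pow_iff finite_subset subsetI)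
  \<comment> \<open>Incomparable sets would make the difference of two height functions vary by at
    least 2 between \<open>e\<close> and \<open>e'\<close>, whereas a unit step allows a variation
    of at most 1.\<close>
  have chain: "S \<subseteq> T \<or> T \<subseteq> S" if ST: "S \<in> C" "T \<in> C" for S T
  proof (rule ccontr)
    assume "\<not> (S \<subseteq> T \<or> T \<subseteq> S)"
    then obtain e e' where e: "e \<in> S" "e \<notin> T" "e' \<in> T" "e' \<notin> S"
      by blast
    then have "e \<in> G" "e' \<in> G"
      using CG ST by auto
    obtain x y where xy: "x \<in> F" "x S \<noteq> 0" "y \<in> F" "y T \<noteq> 0"
      using ST by (auto simp: C_def)
    have less: "height_of G x e < height_of G x e'" "height_of G y e' < height_of G y e"
      using xy e F \<open>e \<in> G\<close> \<open>e' \<in> G\<close> by (auto intro!: height_of_less)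
    have "unit_step G (height_of G x) (height_of G y) \<or> unit_step G (height_of G y) (height_of G x)"
      using steps xy by blast
    then show False
    proof
      assume u: "unit_step G (height_of G x) (height_of G y)"
      show False
        using unit_stepD[OF u \<open>e \<in> G\<close>] unit_stepD[OF u \<open>e' \<in> G\<close>] less by linarith
    next
      assume u: "unit_step G (height_of G y) (height_of G x)"
      show False
        using unit_stepD[OF u \<open>e \<in> G\<close>] unit_stepD[OF u \<open>e' \<in> G\<close>] less by linarith
    qed
  qed
  then have "is_bchain n C"
    using CG G unfolding is_bchain_def by blast
  have rep: "(\<forall>x\<in>F. esd_phi C x T = int r) \<or> (\<exists>e\<in>G. \<forall>x\<in>F. esd_phi C x T = int (height_of G x e))"
    if T: "T \<in> C" for T
  proof (cases "{S\<in>C. \<not> S \<subseteq> T} = {}")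
    case True
    have "esd_phi C x T = int r" if "x \<in> F" for x
    proof -
      have "(\<Sum>S | S \<in> C \<and> S \<subseteq> T. x S) = (\<Sum>S\<in>Pow G. x S)"
      proof (rule sum_nat_eq_if_support_eq)
        fix S assume "x S \<noteq> 0"
        then have "S \<in> C"
          using supp \<open>x \<in> F\<close> by blast
        then show "S \<in> {S. S \<in> C \<and> S \<subseteq> T} \<longleftrightarrow> S \<in> Pow G"
          using True CG by blast
      qed (use finC fin in auto)
      then show ?thesis
        using that F by (auto simp: esd_phi_def esd_points_def)
    qed
    then show ?thesis
      by blast
  next
    case False
    \<comment> \<open>The smallest set of the chain not inside \<open>T\<close> has an element
      outside \<open>T\<close>; the sets missing that element are exactly those inside
      \<open>T\<close>.\<close>
    define U where "U = \<Inter>{S\<in>C. \<not> S \<subseteq> T}"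
    have "subset.chain UNIV {S\<in>C. \<not> S \<subseteq> T}"
      using chain by (auto simp: subset_chain_def)
    then have U: "U \<in> {S\<in>C. \<not> S \<subseteq> T}"
      unfolding U_def using False finC by (intro Inter_in_chain) auto
    then obtain e where e: "e \<in> U" "e \<notin> T"
      by blast
    have "e \<in> G"
      using e(1) U CG by blast
    have "{S\<in>C. S \<subseteq> T} = {S\<in>C. e \<notin> S}"
      using e unfolding U_def by blast
    then have "esd_phi C x T = int (height_of G x e)" if "x \<in> F" for x
      using height_of_eq_sum[of x C e, OF _ finC supp[OF that] \<open>e \<in> G\<close>] that F(1)
      by (auto simp: esd_phi_def)
    then show ?thesis
      using \<open>e \<in> G\<close> by blast
  qed
  have phi: "\<forall>T\<in>C. esd_phi C x T - esd_phi C y T \<in> {0, 1}"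
    if xy: "x \<in> F" "y \<in> F" "unit_step G (height_of G x) (height_of G y)" for x y
  proof
    fix T assume "T \<in> C"
    from rep[OF this] show "esd_phi C x T - esd_phi C y T \<in> {0, 1}"
    proof
      assume "\<exists>e\<in>G. \<forall>x\<in>F. esd_phi C x T = int (height_of G x e)"
      then obtain e where e: "e \<in> G" "\<forall>x\<in>F. esd_phi C x T = int (height_of G x e)"
        by blast
      then have "esd_phi C x T - esd_phi C y T = int (height_of G x e) - int (height_of G y e)"
        using xy(1,2) by simp
      then show ?thesis
        using unit_stepD[OF xy(3) e(1)] by auto
    qed (use xy in simp)
  qed
  have "F \<subseteq> esd_vertices n r"
    using F(1) esd_points_eq[OF G, of r] by blast
  moreover have "\<forall>x\<in>F. \<forall>y\<in>F. (\<forall>T\<in>C. esd_phi C x T - esd_phi C y T \<in> {0, 1}) \<or>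
      (\<forall>T\<in>C. esd_phi C y T - esd_phi C x T \<in> {0, 1})"
  proof (intro ballI)
    fix x y assume xy: "x \<in> F" "y \<in> F"
    have "unit_step G (height_of G x) (height_of G y) \<or> unit_step G (height_of G y) (height_of G x)"
      using steps xy by blast
    then show "(\<forall>T\<in>C. esd_phi C x T - esd_phi C y T \<in> {0, 1}) \<or>
        (\<forall>T\<in>C. esd_phi C y T - esd_phi C x T \<in> {0, 1})"
      using phi[OF xy] phi[OF xy(2,1)] by argo
  qed
  moreover have "\<forall>x\<in>F. \<forall>S. x S \<noteq> 0 \<longrightarrow> S \<in> C"
    using supp by blast
  ultimately show ?face
    unfolding esd_faces_def mem_Collect_eq using F(2) \<open>is_bchain n C\<close> by (intro conjI exI[of _ C])
qed

end

section \<open>Face numbers through residues of sums of height functions\<close>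

definition residue_maps :: "nat \<Rightarrow> nat \<Rightarrow> nat set \<Rightarrow> 'a set \<Rightarrow> ('a \<Rightarrow> nat) set" where
  "residue_maps r m K G = {s \<in> heights (r * m) G. (\<lambda>e. s e mod m) ` G = K}"

definition step_families :: "nat \<Rightarrow> nat \<Rightarrow> 'a set \<Rightarrow> ('a \<Rightarrow> nat) set set" where
  "step_families r i G = {\<Gamma>. \<Gamma> \<subseteq> heights r G \<and> finite \<Gamma> \<and> card \<Gamma> = i \<and>
     (\<forall>g\<in>\<Gamma>. \<forall>h\<in>\<Gamma>. unit_step G g h \<or> unit_step G h g)}"

lemma finite_heights: "finite G \<Longrightarrow> finite (heights r G)"
  unfolding heights_def by (rule finite_subset[of _ "G \<rightarrow>\<^sub>E {0..r}"]) (auto intro: finite_PiE)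

text \<open>Hermite's identity. Passing from \<open>m\<close> to \<open>Suc m\<close> shifts the sum
  by one index, replacing \<open>m div i\<close> by \<open>(m + i) div i\<close>, which is one
  more.\<close>

lemma sum_add_div:
  fixes i :: nat
  assumes "i > 0"
  shows "(\<Sum>j<i. (m + j) div i) = m"
proof (induction m)
  case 0
  show ?case
    by simp
next
  case (Suc m)
  have "(\<Sum>j<i. (Suc m + j) div i) + m div i = (\<Sum>j<Suc i. (m + j) div i)"
    by (subst sum.lessThan_Suc_shift) simp
  also have "\<dots> = m + (m + i) div i"
    using Suc by simp
  also have "(m + i) div i = Suc (m div i)"
    using assms by simp
  finally show ?case
    by simp
qed

text \<open>A face with \<open>i\<close> vertices is recovered from the sum \<open>s\<close> of its height functions: the \<open>j\<close>-th
  smallest one is \<open>\<lfloor>(s + j)/i\<rfloor>\<close>.\<close>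

definition shifted_quotients :: "nat \<Rightarrow> 'a set \<Rightarrow> ('a \<Rightarrow> nat) \<Rightarrow> nat \<Rightarrow> 'a \<Rightarrow> nat" where
  "shifted_quotients i G s j = (\<lambda>e\<in>G. (s e + j) div i)"

context
  fixes r i :: nat and G :: "'a set"
  assumes fin: "finite G" and i: "i > 0"
begin

text \<open>Hermite's identity recovers \<open>s\<close> as the sum. The \<open>i\<close> quotients
  are distinct because every residue occurs, and they differ by at most 1 because adding
  \<open>i\<close> raises a quotient by exactly 1.\<close>

lemma shifted_quotients_family:
  assumes s: "s \<in> residue_maps r i {..<i} G"
  shows "shifted_quotients i G s ` {..<i} \<in> step_families r i G"
    and "(\<lambda>e\<in>G. \<Sum>g\<in>shifted_quotients i G s ` {..<i}. g e) = s"
proof -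
  let ?q = "shifted_quotients i G s"
  have sPi: "s \<in> G \<rightarrow>\<^sub>E {0..r * i}" and s0: "\<exists>e\<in>G. s e = 0" and res: "(\<lambda>e. s e mod i) ` G = {..<i}"
    using s by (auto simp: residue_maps_def heights_def)
  have neq: "?q j \<noteq> ?q k" if "j < k" "k < i" for j k
  proof -
    \<comment> \<open>At an element with residue \<open>i - k\<close>, adding \<open>k\<close>
      reaches the next multiple of \<open>i\<close>, while adding the smaller \<open>j\<close> does
      not.\<close>
    have "i - k \<in> (\<lambda>e. s e mod i) ` G"
      unfolding res using that by simp
    then obtain e where e: "e \<in> G" "s e mod i = i - k"
      by auto
    define q where "q = s e div i"
    have "s e = i * q + (i - k)"
      using e(2) q_def by (metis mult_div_mod_eq)
    then have "s e + k = i * Suc q" "s e + j = i * q + (i - (k - j))" "i - (k - j) < i"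
      using that by auto
    then have "(s e + k) div i = Suc q" "(s e + j) div i = q"
      using i by (metis nonzero_mult_div_cancel_left less_numeral_extra(3), metis div_mult_self4 div_less add_0_right less_numeral_extra(3))
    then have "?q j e \<noteq> ?q k e"
      using e(1) by (simp add: shifted_quotients_def)
    then show ?thesis
      by auto
  qed
  then have inj: "inj_on ?q {..<i}"
    by (intro linorder_inj_onI) auto
  have "?q j \<in> heights r G" if "j < i" for j
  proof -
    have "(s e + j) div i \<le> r" if "e \<in> G" for e
    proof -
      have "s e + j < Suc r * i"
        using PiE_mem[OF sPi that] \<open>j < i\<close> by simp
      then have "(s e + j) div i < Suc r"
        by (rule less_mult_imp_div_less)
      then show ?thesis
        by simp
    qed
    moreover obtain e0 where "e0 \<in> G" "s e0 = 0"
      using s0 by blast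
    then have "?q j e0 = 0" "e0 \<in> G"
      using that by (simp_all add: shifted_quotients_def)
    ultimately show ?thesis
      by (auto simp: heights_def shifted_quotients_def)
  qed
  moreover have step: "unit_step G (?q k) (?q j)" if "j \<le> k" "k < i" for j k
    unfolding unit_step_def
  proof
    fix e assume e: "e \<in> G"
    have "(s e + j) div i \<le> (s e + k) div i"
      using that by (intro div_le_mono) simp
    moreover have "(s e + k) div i \<le> (s e + j + i) div i"
      using that by (intro div_le_mono) simp
    ultimately show "?q k e = ?q j e \<or> ?q k e = Suc (?q j e)"
      using e i by (auto simp: shifted_quotients_def)
  qed
  have "unit_step G (?q j) (?q k) \<or> unit_step G (?q k) (?q j)" if "j < i" "k < i" for j k
    using step[of j k] step[of k j] that by (cases "j \<le> k") auto
  ultimately show "?q ` {..<i} \<in> step_families r i G"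
    unfolding step_families_def using inj by (auto simp: card_image)
  show "(\<lambda>e\<in>G. \<Sum>g\<in>?q ` {..<i}. g e) = s"
  proof
    fix e
    show "(\<lambda>e\<in>G. \<Sum>g\<in>?q ` {..<i}. g e) e = s e"
    proof (cases "e \<in> G")
      case True
      then show ?thesis
        using sum_add_div[OF i, of "s e"]
        by (simp add: sum.reindex[OF inj]) (simp add: shifted_quotients_def)
    next
      case False
      then show ?thesis
        using sPi by (auto simp: PiE_def extensional_def)
    qed
  qed
qed

text \<open>At each \<open>e\<close> the members take only their minimum q and q + 1. If t of them
  take q + 1, then \<open>s e\<close> is iq + t, and for j < i the quotient with shift j is q + 1
  precisely when j is at least i - t: these are the ranks of the members with the larger
  value.\<close>

lemma family_shifted_quotients:
  assumes \<Gamma>: "\<Gamma> \<in> step_families r i G"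
  defines "s \<equiv> \<lambda>e\<in>G. \<Sum>g\<in>\<Gamma>. g e"
  shows "shifted_quotients i G s ` {..<i} = \<Gamma>" and "s \<in> residue_maps r i {..<i} G"
proof -
  let ?q = "shifted_quotients i G s"
  have sub: "\<Gamma> \<subseteq> heights r G" and card: "card \<Gamma> = i" and fin\<Gamma>: "finite \<Gamma>"
    and comp: "\<And>g h. g \<in> \<Gamma> \<Longrightarrow> h \<in> \<Gamma> \<Longrightarrow> unit_step G g h \<or> unit_step G h g"
    using \<Gamma> by (auto simp: step_families_def)
  \<comment> \<open>Counting the other members pointwise below gives positions starting from 0, as
    the shifts do.\<close>
  define below where "below g = {h\<in>\<Gamma>. h \<noteq> g \<and> (\<forall>e\<in>G. h e \<le> g e)}" for g
  define rank where "rank g = card (below g)" for g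
  have rank: "rank g < i" if "g \<in> \<Gamma>" for g
    unfolding rank_def card[symmetric] using fin\<Gamma> that
    by (intro psubset_card_mono) (auto simp: below_def)
  have eq: "?q (rank g) e = g e" if g: "g \<in> \<Gamma>" and e: "e \<in> G" for g e
  proof -
    define q where "q = Min ((\<lambda>h. h e) ` \<Gamma>)"
    have "\<Gamma> \<noteq> {}"
      using g by auto
    then have "q \<in> (\<lambda>h. h e) ` \<Gamma>"
      unfolding q_def using fin\<Gamma> by (intro Min_in) auto
    then obtain h0 where h0: "h0 \<in> \<Gamma>" "h0 e = q"
      by auto
    have q_le: "q \<le> h e" if "h \<in> \<Gamma>" for h
      unfolding q_def using fin\<Gamma> that by (intro Min_le) auto
    have two: "h e = q \<or> h e = Suc q" if "h \<in> \<Gamma>" for h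
      using comp[OF that h0(1)] q_le[OF that] h0(2) e unfolding unit_step_def by fastforce
    define T where "T = {h\<in>\<Gamma>. h e = Suc q}"
    have T: "T \<subseteq> \<Gamma>" "finite T"
      using fin\<Gamma> by (auto simp: T_def)
    have "(\<Sum>h\<in>\<Gamma>. h e) = (\<Sum>h\<in>\<Gamma>. q + (if h \<in> T then 1 else 0))"
      using two by (intro sum.cong) (auto simp: T_def)
    also have "\<dots> = i * q + card T"
      using fin\<Gamma> T card by (simp add: sum.distrib sum.If_cases Int_absorb1)
    finally have s: "s e = i * q + card T"
      using e by (simp add: s_def)
    have "h0 \<notin> T"
      using h0 by (simp add: T_def)
    then have "T \<subset> \<Gamma>"
      using h0(1) T(1) by blast
    then have cT: "card (\<Gamma> - T) = i - card T" "card T < i"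
      using T card fin\<Gamma> psubset_card_mono[of \<Gamma> T] by (simp_all add: card_Diff_subset)
    show ?thesis
    proof (cases "g e = q")
      case True
      have "below g \<subseteq> (\<Gamma> - T) - {g}"
        using True e by (force simp: below_def T_def)
      then have "rank g \<le> card ((\<Gamma> - T) - {g})"
        unfolding rank_def using fin\<Gamma> by (intro card_mono) auto
      also have "\<dots> = i - card T - 1"
        using True g cT by (subst card_Diff_singleton) (auto simp: T_def)
      finally have "card T + rank g < i"
        using cT by linarith
      then show ?thesis
        using e True s i by (simp add: shifted_quotients_def add.assoc)
    next
      case False
      then have ge: "g e = Suc q"
        using two g by auto
      have "\<Gamma> - T \<subseteq> below g"
      proof
        fix h assume h: "h \<in> \<Gamma> - T"
        then have "h e = q"
          using two by (auto simp: T_def)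
        then have "unit_step G g h"
          using comp[of g h] h g ge e unfolding unit_step_def by fastforce
        then show "h \<in> below g"
          using h ge \<open>h e = q\<close> unfolding below_def unit_step_def by force
      qed
      then have "i - card T \<le> rank g"
        unfolding rank_def cT(1)[symmetric] using fin\<Gamma> by (intro card_mono) (auto simp: below_def)
      then obtain k where k: "card T + rank g = i + k" "k < i"
        using rank[OF g] cT(2) by (metis add.commute add_less_mono le_Suc_ex le_diff_conv nat_add_left_cancel_less)
      then have "s e + rank g = i * Suc q + k"
        using s by simp
      then have "(s e + rank g) div i = Suc q"
        using k(2) i by (metis div_mult_self4 div_less add_0_right less_numeral_extra(3))
      then show ?thesis
        using e ge by (simp add: shifted_quotients_def)
    qed
  qed
  have "?q (rank g) = g" if g: "g \<in> \<Gamma>" for g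
  proof
    fix e
    show "?q (rank g) e = g e"
    proof (cases "e \<in> G")
      case False
      then show ?thesis
        using g sub by (auto simp: heights_def shifted_quotients_def PiE_def extensional_def)
    qed (use eq g in auto)
  qed
  then have "\<Gamma> \<subseteq> ?q ` {..<i}"
    using rank by (metis image_eqI lessThan_iff subsetI)
  moreover have "card (?q ` {..<i}) \<le> card \<Gamma>"
    using card card_image_le[of "{..<i}" ?q] by simp
  ultimately show img: "?q ` {..<i} = \<Gamma>"
    using card_seteq[of "?q ` {..<i}" \<Gamma>] by auto
  then have inj: "inj_on ?q {..<i}"
    using card by (intro eq_card_imp_inj_on) auto
  \<comment> \<open>Even the member with the largest shift has a zero, and there
    \<open>s e0 + (i - 1) < i\<close>.\<close>
  have "?q (i - 1) \<in> heights r G"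
    using img sub i by auto
  then obtain e0 where e0: "e0 \<in> G" "(s e0 + (i - 1)) div i = 0"
    by (auto simp: heights_def shifted_quotients_def)
  then have s0: "s e0 = 0"
    using i by (simp add: div_eq_0_iff)
  have "s e \<le> r * i" if "e \<in> G" for e
  proof -
    have "(\<Sum>g\<in>\<Gamma>. g e) \<le> of_nat (card \<Gamma>) * r"
      using sub that by (intro sum_bounded_above) (auto simp: heights_def PiE_iff)
    then show ?thesis
      using that card by (simp add: s_def mult.commute)
  qed
  then have "s \<in> heights (r * i) G"
    using e0 s0 by (auto simp: heights_def s_def)
  moreover have "k \<in> (\<lambda>e. s e mod i) ` G" if k: "k < i" for k
  proof (cases "k = 0")
    case True
    then show ?thesis
      using e0 s0 by force
  next
    case False
    \<comment> \<open>Residue \<open>k\<close> is attained where the members with shifts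
      \<open>i - k - 1\<close> and \<open>i - k\<close> differ: there \<open>s e + (i - k)\<close>
      is a multiple of \<open>i\<close>.\<close>
    then have "?q (i - k) \<noteq> ?q (i - k - 1)"
      using inj_onD[OF inj, of "i - k" "i - k - 1"] k False by auto
    then obtain e where "?q (i - k) e \<noteq> ?q (i - k - 1) e"
      by blast
    then have e: "e \<in> G" "(s e + (i - k)) div i \<noteq> (s e + (i - k - 1)) div i"
      unfolding shifted_quotients_def restrict_def by meson+
    have "s e + (i - k) = Suc (s e + (i - k - 1))"
      using k by simp
    with e(2) have "(s e + (i - k)) mod i = 0"
      using div_Suc[of "s e + (i - k - 1)" i] by (auto split: if_splits)
    then have "(s e mod i + (i - k)) mod i = 0"
      by (simp add: mod_add_left_eq)
    moreover have "s e mod i < i"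
      using i by simp
    ultimately have "s e mod i + (i - k) = i"
      using k False by (cases "s e mod i + (i - k) < i") (auto simp: le_mod_geq not_less)
    then have "s e mod i = k"
      using k by simp
    then show ?thesis
      using e(1) by force
  qed
  ultimately show "s \<in> residue_maps r i {..<i} G"
    using i by (auto simp: residue_maps_def)
qed

lemma card_step_families: "card (step_families r i G) = card (residue_maps r i {..<i} G)"
proof -
  have "bij_betw (\<lambda>s. shifted_quotients i G s ` {..<i}) (residue_maps r i {..<i} G) (step_families r i G)"
    by (rule bij_betw_byWitness[where f' = "\<lambda>\<Gamma>. \<lambda>e\<in>G. \<Sum>g\<in>\<Gamma>. g e"])
      (use shifted_quotients_family family_shifted_quotients in blast)+
  then show ?thesis
    by (simp add: bij_betw_same_card)
qed

end

lemma card_esd_restrict: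
  assumes G: "G \<subseteq> {1..n}" and r: "r > 0" and i: "i > 0"
  shows "card {F \<in> esd_restrict n r G. card F = i} = card (residue_maps r i {..<i} G)"
proof -
  have fin: "finite G"
    using G finite_subset by blast
  let ?h = "height_of G" and ?o = "of_height r G"
  have faces: "{F \<in> esd_restrict n r G. card F = i} = {F. F \<subseteq> esd_points r G \<and> finite F \<and> card F = i \<and>
      (\<forall>x\<in>F. \<forall>y\<in>F. unit_step G (?h x) (?h y) \<or> unit_step G (?h y) (?h x))}"
  proof (rule set_eqI)
    fix F
    have "F \<in> esd_restrict n r G \<longleftrightarrow> F \<in> esd_faces n r \<and> F \<subseteq> esd_points r G \<and> finite F"
      unfolding esd_points_eq[OF G, symmetric] esd_restrict_def esd_faces_def by blast
    then show "F \<in> {F \<in> esd_restrict n r G. card F = i} \<longleftrightarrow> F \<in> {F. F \<subseteq> esd_points r G \<and> finite F \<and> card F = i \<and>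
      (\<forall>x\<in>F. \<forall>y\<in>F. unit_step G (?h x) (?h y) \<or> unit_step G (?h y) (?h x))}"
      using face_iff_unit_step[OF fin r _ _ G, of F] by auto
  qed
  have inv: "?o (?h x) = x" if "x \<in> esd_points r G" for x
    using of_height_height_of[OF fin r that] .
  have inv': "?h (?o g) = g" if "g \<in> heights r G" for g
    using height_of_of_height[OF fin r that] .
  have injh: "inj_on ?h (esd_points r G)"
    by (rule inj_on_inverseI[where g = ?o]) (rule inv)
  have injo: "inj_on ?o (heights r G)"
    by (rule inj_on_inverseI[where g = ?h]) (rule inv')
  have "bij_betw (image ?h) {F \<in> esd_restrict n r G. card F = i} (step_families r i G)"
    unfolding faces
  proof (rule bij_betw_byWitness[where f' = "image ?o"])
    show "image ?h ` {F. F \<subseteq> esd_points r G \<and> finite F \<and> card F = i \<and>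
      (\<forall>x\<in>F. \<forall>y\<in>F. unit_step G (?h x) (?h y) \<or> unit_step G (?h y) (?h x))} \<subseteq> step_families r i G"
    proof clarify
      fix F assume F: "F \<subseteq> esd_points r G" "finite F" "i = card F"
        and step: "\<forall>x\<in>F. \<forall>y\<in>F. unit_step G (?h x) (?h y) \<or> unit_step G (?h y) (?h x)"
      have "?h ` F \<subseteq> heights r G"
        using F(1) height_of_in_heights[OF fin r] by blast
      moreover have "card (?h ` F) = card F"
        using card_image[OF inj_on_subset[OF injh F(1)]] .
      ultimately show "?h ` F \<in> step_families r (card F) G"
        unfolding step_families_def using F(2) step by blast
    qed
    show "image ?o ` step_families r i G \<subseteq> {F. F \<subseteq> esd_points r G \<and> finite F \<and> card F = i \<and>
      (\<forall>x\<in>F. \<forall>y\<in>F. unit_step G (?h x) (?h y) \<or> unit_step G (?h y) (?h x))}"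
    proof clarify
      fix \<Gamma> assume "\<Gamma> \<in> step_families r i G"
      then have \<Gamma>: "\<Gamma> \<subseteq> heights r G" "finite \<Gamma>" "card \<Gamma> = i"
        "\<And>g h. g \<in> \<Gamma> \<Longrightarrow> h \<in> \<Gamma> \<Longrightarrow> unit_step G g h \<or> unit_step G h g"
        by (auto simp: step_families_def)
      have "?h (?o g) = g" if "g \<in> \<Gamma>" for g
        using inv' \<Gamma>(1) that by blast
      then show "?o ` \<Gamma> \<subseteq> esd_points r G \<and> finite (?o ` \<Gamma>) \<and> card (?o ` \<Gamma>) = i \<and>
        (\<forall>x\<in>?o ` \<Gamma>. \<forall>y\<in>?o ` \<Gamma>. unit_step G (?h x) (?h y) \<or> unit_step G (?h y) (?h x))"
        using \<Gamma> of_height_in_points[OF fin r] card_image[OF inj_on_subset[OF injo \<Gamma>(1)]] by auto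
    qed
  qed (use inv inv' in \<open>auto simp: step_families_def image_image subset_iff\<close>)
  then show ?thesis
    using card_step_families[OF fin i, of r] by (simp add: bij_betw_same_card)
qed

definition transport_residues :: "nat \<Rightarrow> nat \<Rightarrow> (nat \<Rightarrow> nat) \<Rightarrow> 'a set \<Rightarrow> ('a \<Rightarrow> nat) \<Rightarrow> 'a \<Rightarrow> nat" where
  "transport_residues i m \<phi> G s = (\<lambda>e\<in>G. m * (s e div i) + \<phi> (s e mod i))"

lemma transport_residues_maps:
  assumes i: "i > 0" and K': "\<phi> ` K = K'" "K' \<subseteq> {..<m}" and \<phi>0: "\<phi> 0 = 0"
    and s: "s \<in> residue_maps r i K G"
  shows "transport_residues i m \<phi> G s \<in> residue_maps r m K' G"
    and "(\<And>k. k \<in> K \<Longrightarrow> \<psi> (\<phi> k) = k) \<Longrightarrow> transport_residues m i \<psi> G (transport_residues i m \<phi> G s) = s"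
proof -
  let ?t = "transport_residues i m \<phi> G s"
  have sPi: "s \<in> G \<rightarrow>\<^sub>E {0..r * i}" and s0: "\<exists>e\<in>G. s e = 0" and res: "(\<lambda>e. s e mod i) ` G = K"
    using s by (auto simp: residue_maps_def heights_def)
  have \<phi>: "\<phi> (s e mod i) < m" if "e \<in> G" for e
    using that res K' by blast
  have dm: "?t e div m = s e div i" "?t e mod m = \<phi> (s e mod i)" if "e \<in> G" for e
    using \<phi>[OF that] that by (simp_all add: transport_residues_def)
  have "?t e \<le> r * m" if e: "e \<in> G" for e
  proof (cases "s e = r * i")
    case True
    then show ?thesis
      using e i \<phi>0 by (simp add: transport_residues_def)
  next
    case False
    then have "s e < r * i"
      using PiE_mem[OF sPi e] by simp
    then have "s e div i < r"
      by (rule less_mult_imp_div_less)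
    then have "m * Suc (s e div i) \<le> m * r"
      by (intro mult_le_mono2) simp
    then show ?thesis
      using \<phi>[OF e] e by (simp add: transport_residues_def mult.commute[of r])
  qed
  moreover obtain e0 where "e0 \<in> G" "s e0 = 0"
    using s0 by blast
  then have "?t e0 = 0" "e0 \<in> G"
    using \<phi>0 by (simp_all add: transport_residues_def)
  ultimately have "?t \<in> heights (r * m) G"
    by (auto simp: heights_def transport_residues_def)
  moreover have "(\<lambda>e. ?t e mod m) ` G = \<phi> ` (\<lambda>e. s e mod i) ` G"
    unfolding image_image using dm by (intro image_cong) auto
  ultimately show "?t \<in> residue_maps r m K' G"
    using res K' by (simp add: residue_maps_def)
  assume \<psi>: "\<And>k. k \<in> K \<Longrightarrow> \<psi> (\<phi> k) = k"
  show "transport_residues m i \<psi> G ?t = s"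
  proof
    fix e
    show "transport_residues m i \<psi> G ?t e = s e"
    proof (cases "e \<in> G")
      case True
      then have "\<psi> (\<phi> (s e mod i)) = s e mod i"
        using \<psi> res by blast
      then show ?thesis
        using True dm[OF True] by (simp add: transport_residues_def[of m i])
    next
      case False
      then show ?thesis
        using sPi by (auto simp: transport_residues_def PiE_def extensional_def)
    qed
  qed
qed

text \<open>Only the number of residues matters: renaming residues by a bijection that fixes \<open>0\<close> preserves
  the bound \<open>r * m\<close>, which is attained only at residue \<open>0\<close>.\<close>

lemma card_residue_maps:
  assumes K: "K \<subseteq> {..<m}" "0 \<in> K"
  shows "card (residue_maps r m K G) = card (residue_maps r (card K) {..<card K} G)"
proof -
  let ?i = "card K"
  have finK: "finite K"
    using K finite_subset by blast
  have i: "?i > 0"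
    using K finK card_gt_0_iff by blast
  have m: "m > 0"
    using K by auto
  have "card {1..<?i} = card (K - {0})"
    using K finK by simp
  then obtain k where k: "bij_betw k {1..<?i} (K - {0})"
    using finK by (metis finite_Diff finite_atLeastLessThan finite_same_card_bij)
  define \<phi> where "\<phi> = k(0 := 0)"
  have "bij_betw \<phi> {1..<?i} (K - {0})"
    using k by (rule bij_betw_cong[THEN iffD1, rotated]) (simp add: \<phi>_def)
  moreover have "bij_betw \<phi> {0} {0}"
    by (simp add: \<phi>_def bij_betw_def)
  ultimately have "bij_betw \<phi> ({1..<?i} \<union> {0}) (K - {0} \<union> {0})"
    by (rule bij_betw_combine) simp
  moreover have "{1..<?i} \<union> {0} = {..<?i}" "K - {0} \<union> {0} = K"
    using i K by auto
  ultimately have bij: "bij_betw \<phi> {..<?i} K"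
    by simp
  define \<psi> where "\<psi> = inv_into {..<?i} \<phi>"
  have \<phi>0: "\<phi> 0 = 0"
    by (simp add: \<phi>_def)
  have inv: "\<psi> (\<phi> j) = j" if "j \<in> {..<?i}" for j
    using bij that by (simp add: \<psi>_def bij_betw_def inv_into_f_f)
  have inv': "\<phi> (\<psi> j) = j" if "j \<in> K" for j
    using bij that by (simp add: \<psi>_def bij_betw_inv_into_right)
  have img: "\<phi> ` {..<?i} = K"
    using bij by (simp add: bij_betw_def)
  have img': "\<psi> ` K = {..<?i}"
    using bij bij_betw_inv_into unfolding \<psi>_def bij_betw_def by blast
  have \<psi>0: "\<psi> 0 = 0"
    using inv[of 0] i \<phi>0 by simp
  note fwd = transport_residues_maps[OF i img K(1) \<phi>0]
  note bwd = transport_residues_maps[OF m img' order_refl \<psi>0]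
  have "bij_betw (transport_residues ?i m \<phi> G) (residue_maps r ?i {..<?i} G) (residue_maps r m K G)"
    by (rule bij_betw_byWitness[where f' = "transport_residues m ?i \<psi> G"])
      (use fwd(1) fwd(2)[where \<psi> = \<psi>, OF _ inv] bwd(1) bwd(2)[where \<psi> = \<phi>, OF _ inv'] in blast)+
  then show ?thesis
    by (simp add: bij_betw_same_card)
qed

section \<open>Lattice-point counts in terms of face numbers\<close>

lemma card_heights:
  assumes "finite G"
  shows "card (heights m G) = (m + 1) ^ card G - m ^ card G"
proof -
  have "heights m G = (G \<rightarrow>\<^sub>E {0..m}) - (G \<rightarrow>\<^sub>E {1..m})"
  proof (rule set_eqI)
    fix g
    show "g \<in> heights m G \<longleftrightarrow> g \<in> (G \<rightarrow>\<^sub>E {0..m}) - (G \<rightarrow>\<^sub>E {1..m})"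
    proof (cases "g \<in> G \<rightarrow>\<^sub>E {0..m}")
      case True
      then have "g \<in> G \<rightarrow>\<^sub>E {1..m} \<longleftrightarrow> (\<forall>e\<in>G. g e \<noteq> 0)"
        by (force simp: PiE_iff)
      then show ?thesis
        using True by (simp add: heights_def)
    qed (simp add: heights_def)
  qed
  moreover have "(G \<rightarrow>\<^sub>E {1..m}) \<subseteq> (G \<rightarrow>\<^sub>E {0..m})"
    by (intro PiE_mono) auto
  ultimately show ?thesis
    using assms by (simp add: card_Diff_subset finite_PiE card_PiE)
qed

lemma sum_subsets_containing:
  fixes f :: "nat \<Rightarrow> nat"
  shows "(\<Sum>K | K \<subseteq> {..<Suc m} \<and> 0 \<in> K. f (card K)) = (\<Sum>i\<le>m. (m choose i) * f (Suc i))"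
proof -
  have "(\<Sum>K | K \<subseteq> {..<Suc m} \<and> 0 \<in> K. f (card K)) = (\<Sum>L\<in>Pow {1..m}. f (Suc (card L)))"
  proof (rule sum.reindex_bij_witness[of _ "insert 0" "\<lambda>K. K - {0}"])
    fix K assume "K \<in> {K. K \<subseteq> {..<Suc m} \<and> 0 \<in> K}"
    then have "Suc (card (K - {0})) = card K"
      by (intro card_Suc_Diff1) (auto intro: finite_subset)
    then show "f (Suc (card (K - {0}))) = f (card K)"
      by simp
  qed auto
  also have "\<dots> = (\<Sum>i\<le>m. \<Sum>L | L \<in> Pow {1..m} \<and> card L = i. f (Suc (card L)))"
    by (intro sum.group[symmetric]) (auto dest!: card_mono[rotated])
  also have "\<dots> = (\<Sum>i\<le>m. (m choose i) * f (Suc i))"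
  proof (intro sum.cong refl)
    fix i
    have "(\<Sum>L | L \<in> Pow {1..m} \<and> card L = i. f (Suc (card L))) = (\<Sum>L | L \<in> Pow {1..m} \<and> card L = i. f (Suc i))"
      by (intro sum.cong) auto
    then show "(\<Sum>L | L \<in> Pow {1..m} \<and> card L = i. f (Suc (card L))) = (m choose i) * f (Suc i)"
      using n_subsets[of "{1..m}" i] by simp
  qed
  finally show ?thesis .
qed

text \<open>Height functions are sorted by their set of residues modulo m + 1. The residue 0 always
  occurs, so a set of i + 1 residues can be chosen in \<open>m choose i\<close> ways, and only its
  size matters.\<close>

lemma card_heights_residues:
  assumes fin: "finite G"
  shows "card (heights (r * Suc m) G) = (\<Sum>i\<le>m. (m choose i) * card (residue_maps r (Suc i) {..<Suc i} G))"
proof -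
  let ?K = "{K. K \<subseteq> {..<Suc m} \<and> 0 \<in> K}"
  have img: "(\<lambda>e. s e mod Suc m) ` G \<in> ?K" if "s \<in> heights (r * Suc m) G" for s
    using that by (force simp: heights_def)
  have "card (heights (r * Suc m) G) = (\<Sum>s\<in>heights (r * Suc m) G. 1)"
    by simp
  also have "\<dots> = (\<Sum>K\<in>?K. \<Sum>s | s \<in> heights (r * Suc m) G \<and> (\<lambda>e. s e mod Suc m) ` G = K. 1)"
    using img finite_heights[OF fin] by (intro sum.group[symmetric]) auto
  also have "\<dots> = (\<Sum>K\<in>?K. card (residue_maps r (card K) {..<card K} G))"
    by (intro sum.cong refl, subst card_residue_maps[symmetric, of _ "Suc m"]) (auto simp: residue_maps_def)
  also have "\<dots> = (\<Sum>i\<le>m. (m choose i) * card (residue_maps r (Suc i) {..<Suc i} G))"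
    by (rule sum_subsets_containing)
  finally show ?thesis .
qed

lemma residue_maps_empty:
  assumes "finite G" "card G < i"
  shows "residue_maps r i {..<i} G = {}"
proof -
  have "(\<lambda>e. s e mod i) ` G \<noteq> {..<i}" for s :: "'a \<Rightarrow> nat"
  proof
    assume "(\<lambda>e. s e mod i) ` G = {..<i}"
    then have "i \<le> card G"
      using card_image_le[OF assms(1), of "\<lambda>e. s e mod i"] by simp
    then show False
      using assms(2) by simp
  qed
  then show ?thesis
    by (auto simp: residue_maps_def)
qed

section \<open>The local h-polynomial\<close>

lemma sums_partial_sums:
  fixes c :: "nat \<Rightarrow> real"
  assumes z: "0 \<le> z" "z < 1" and c: "\<And>m. 0 \<le> c m" and sums: "(\<lambda>m. c m * z ^ m) sums \<sigma>"
  shows "(\<lambda>m. (\<Sum>j\<le>m. c j) * z ^ m) sums (\<sigma> / (1 - z))"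
proof -
  have geo: "(\<lambda>m. z ^ m) sums (1 / (1 - z))"
    using z by (intro geometric_sums) simp
  have "(\<lambda>m. \<Sum>j\<le>m. (c j * z ^ j) * z ^ (m - j)) sums ((\<Sum>m. c m * z ^ m) * (\<Sum>m. z ^ m))"
    by (rule Cauchy_product_sums) (use sums geo c z in \<open>auto simp: sums_iff abs_mult\<close>)
  moreover have "(\<Sum>j\<le>m. (c j * z ^ j) * z ^ (m - j)) = (\<Sum>j\<le>m. c j) * z ^ m" for m
    unfolding sum_distrib_right by (intro sum.cong) (auto simp: mult.assoc simp flip: power_add)
  ultimately show ?thesis
    using sums geo by (simp add: sums_iff)
qed

lemma binomial_sums:
  fixes z :: real
  assumes z: "0 \<le> z" "z < 1"
  shows "(\<lambda>m. (m choose i) * z ^ m) sums (z ^ i / (1 - z) ^ Suc i)"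
proof (induction i)
  case 0
  show ?case
    using z geometric_sums[of z] by simp
next
  case (Suc i)
  have "(\<lambda>m. (\<Sum>j\<le>m. real (j choose i)) * z ^ m) sums (z ^ i / (1 - z) ^ Suc i / (1 - z))"
    by (rule sums_partial_sums[OF z _ Suc]) simp
  also have "(\<lambda>m. (\<Sum>j\<le>m. real (j choose i)) * z ^ m) = (\<lambda>m. (Suc m choose Suc i) * z ^ m)"
    by (simp only: of_nat_sum[symmetric] sum_choose_upper)
  finally have "(\<lambda>m. z * ((Suc m choose Suc i) * z ^ m)) sums (z * (z ^ i / (1 - z) ^ Suc i / (1 - z)))"
    by (rule sums_mult)
  then have "(\<lambda>m. (Suc m choose Suc i) * z ^ Suc m) sums (z ^ Suc i / (1 - z) ^ Suc (Suc i))"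
    by (simp add: mult_ac)
  from sums_Suc[of "\<lambda>m. (m choose Suc i) * z ^ m", OF this] show ?case
    by simp
qed

text \<open>Euler's power series for the Eulerian polynomials. The increments of the n-th powers
  expand into lower powers of m + 1, the Appell expansion at \<alpha> = z gives the matching
  recursion for the numerators, and partial summation divides by 1 - z.\<close>

lemma eulerian_sums:
  fixes z :: real
  assumes z: "0 \<le> z" "z < 1"
  shows "(\<lambda>m. (real m + 1) ^ n * z ^ m) sums (exc_enum n 1 z 1 / (1 - z) ^ Suc n)"
proof (induction n rule: less_induct)
  case (less n)
  show ?case
  proof (cases "n = 0")
    case True
    then show ?thesis
      using z geometric_sums[of z] by simp
  next
    case False
    define c where "c m = (real m + 1) ^ n - real m ^ n" for m :: nat
    let ?A = "\<lambda>k. exc_enum k 1 z 1"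
    have "real m ^ n = (\<Sum>k\<le>n. (n choose k) * (real m + 1) ^ k * (- 1) ^ (n - k))" for m
      using binomial_ring[of "real m + 1" "- 1" n] by simp
    then have c: "c m = - (\<Sum>k<n. (n choose k) * (real m + 1) ^ k * (- 1) ^ (n - k))" for m
      by (simp add: c_def sum.atMost_Suc lessThan_Suc_atMost[symmetric])
    have "(\<lambda>m. - (\<Sum>k<n. (n choose k) * (- 1) ^ (n - k) * ((real m + 1) ^ k * z ^ m)))
      sums (- (\<Sum>k<n. (n choose k) * (- 1) ^ (n - k) * (?A k / (1 - z) ^ Suc k)))"
      by (intro sums_minus sums_sum sums_mult less.IH) simp
    also have "(\<lambda>m. - (\<Sum>k<n. (n choose k) * (- 1) ^ (n - k) * ((real m + 1) ^ k * z ^ m))) = (\<lambda>m. c m * z ^ m)"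
      by (simp add: c sum_distrib_left sum_distrib_right mult_ac)
    also have "- (\<Sum>k<n. (n choose k) * (- 1) ^ (n - k) * (?A k / (1 - z) ^ Suc k)) = ?A n / (1 - z) ^ n"
    proof -
      define S where "S = (\<Sum>k<n. (n choose k) * (- 1) ^ (n - k) * (?A k / (1 - z) ^ Suc k))"
      have "z * ?A n = (\<Sum>k\<le>n. (n choose k) * (z - 1) ^ (n - k) * ?A k)"
        using exc_enum_weak[of n 1 z] exc_enum_appell[of n z z 1] False by simp
      then have "(1 - z) * ?A n = - (\<Sum>k<n. (n choose k) * (z - 1) ^ (n - k) * ?A k)"
        by (simp add: lessThan_Suc_atMost[symmetric] algebra_simps)
      moreover have "(z - 1) ^ (n - k) = (- 1) ^ (n - k) * (1 - z) ^ Suc n / (1 - z) ^ Suc k" if "k < n" for k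
      proof -
        have "(1 - z) ^ Suc n = (1 - z) ^ (n - k) * (1 - z) ^ Suc k"
          using that by (simp flip: power_add)
        moreover have "(z - 1) ^ (n - k) = (- 1) ^ (n - k) * (1 - z) ^ (n - k)"
          by (simp flip: power_mult_distrib)
        ultimately show ?thesis
          using z by simp
      qed
      then have "(\<Sum>k<n. (n choose k) * (z - 1) ^ (n - k) * ?A k)
          = S * (1 - z) ^ Suc n"
        unfolding S_def sum_distrib_right by (intro sum.cong) auto
      ultimately have "(1 - z) * (?A n + S * (1 - z) ^ n) = 0"
        by (simp add: algebra_simps)
      then have "?A n = - S * (1 - z) ^ n"
        using z by (simp add: eq_neg_iff_add_eq_0)
      then show ?thesis
        unfolding S_def[symmetric] using z by simp
    qed
    finally have "(\<lambda>m. (\<Sum>j\<le>m. c j) * z ^ m) sums (?A n / (1 - z) ^ n / (1 - z))"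
      by (intro sums_partial_sums[OF z]) (auto simp: c_def power_mono)
    moreover have "(\<Sum>j\<le>m. c j) = (real m + 1) ^ n" for m
      by (induction m) (use False in \<open>auto simp: c_def add.commute zero_power\<close>)
    ultimately show ?thesis
      by (simp add: mult.commute)
  qed
qed

text \<open>Binomial expansion in \<beta> and (1 - z)(m + 1) turns the series into the Appell
  expansion at \<alpha> = \<beta> + 1.\<close>

lemma exc_enum_sums:
  fixes z :: real
  assumes z: "0 \<le> z" "z < 1"
  shows "(\<lambda>m. ((1 - z) * (real m + 1) + \<beta>) ^ n * z ^ m) sums (exc_enum n (\<beta> + 1) z 1 / (1 - z))"
proof -
  have "(\<lambda>m. \<Sum>k\<le>n. (n choose k) * (1 - z) ^ k * \<beta> ^ (n - k) * ((real m + 1) ^ k * z ^ m))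
    sums (\<Sum>k\<le>n. (n choose k) * (1 - z) ^ k * \<beta> ^ (n - k) * (exc_enum k 1 z 1 / (1 - z) ^ Suc k))"
    by (intro sums_sum sums_mult eulerian_sums z)
  also have "(\<lambda>m. \<Sum>k\<le>n. (n choose k) * (1 - z) ^ k * \<beta> ^ (n - k) * ((real m + 1) ^ k * z ^ m))
      = (\<lambda>m. ((1 - z) * (real m + 1) + \<beta>) ^ n * z ^ m)"
  proof
    fix m :: nat
    have "((1 - z) * (real m + 1) + \<beta>) ^ n
        = (\<Sum>k\<le>n. (n choose k) * ((1 - z) * (real m + 1)) ^ k * \<beta> ^ (n - k))"
      by (rule binomial_ring)
    then show "(\<Sum>k\<le>n. (n choose k) * (1 - z) ^ k * \<beta> ^ (n - k) * ((real m + 1) ^ k * z ^ m))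
        = ((1 - z) * (real m + 1) + \<beta>) ^ n * z ^ m"
      by (simp add: sum_distrib_left sum_distrib_right power_mult_distrib mult_ac)
  qed
  also have "(\<Sum>k\<le>n. (n choose k) * (1 - z) ^ k * \<beta> ^ (n - k) * (exc_enum k 1 z 1 / (1 - z) ^ Suc k))
      = exc_enum n (\<beta> + 1) z 1 / (1 - z)"
    unfolding exc_enum_appell[of n "\<beta> + 1"] sum_divide_distrib using z
    by (intro sum.cong) (auto simp: field_simps)
  finally show ?thesis .
qed

text \<open>For m > 0 the coefficient counts the height functions bounded by rm, which expands in
  the face numbers with binomial coefficients over m - 1. The binomial series turns this into the
  h-polynomial divided by the power of 1 - z.\<close>

lemma poly_h_poly_esd_sums:
  assumes G: "G \<subseteq> {1..n}" "G \<noteq> {}" and r: "r > 0" and z: "0 < z" "z < 1"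
  shows "(\<lambda>m. ((real r * real m + 1) ^ card G - (real r * real m) ^ card G) * z ^ m) sums
    (poly (h_poly (card G) (esd_restrict n r G)) z / (1 - z) ^ card G)"
proof -
  have fin: "finite G"
    using G finite_subset by blast
  define k where "k = card G"
  have k: "k > 0"
    using fin G by (simp add: k_def card_gt_0_iff)
  define f where "f i = real (card (residue_maps r i {..<i} G))" for i
  have f0: "f i = 0" if "k < i" for i
    using residue_maps_empty[OF fin, of i r] that by (simp add: f_def k_def)
  define N where "N m = (real r * real m + 1) ^ k - (real r * real m) ^ k" for m :: nat
  have N: "N (Suc m) = (\<Sum>i<k. (m choose i) * f (Suc i))" for m
  proof -
    have "N (Suc m) = real ((r * Suc m + 1) ^ k - (r * Suc m) ^ k)"
      unfolding N_def by (subst of_nat_diff) (auto intro: power_mono simp: algebra_simps)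
    also have "\<dots> = real (card (heights (r * Suc m) G))"
      by (simp add: card_heights[OF fin] k_def)
    also have "\<dots> = (\<Sum>i\<le>m. (m choose i) * f (Suc i))"
      unfolding card_heights_residues[OF fin] by (simp add: f_def)
    also have "\<dots> = (\<Sum>i<k + Suc m. (m choose i) * f (Suc i))"
      by (rule sum.mono_neutral_left) (auto simp: binomial_eq_0)
    also have "\<dots> = (\<Sum>i<k. (m choose i) * f (Suc i))"
      by (rule sum.mono_neutral_right) (auto simp: f0)
    finally show ?thesis .
  qed
  have "(\<lambda>m. \<Sum>i<k. f (Suc i) * z * ((m choose i) * z ^ m)) sums
      (\<Sum>i<k. f (Suc i) * z * (z ^ i / (1 - z) ^ Suc i))"
    by (intro sums_sum sums_mult binomial_sums) (use z in auto)
  then have "(\<lambda>m. N (Suc m) * z ^ Suc m) sums (\<Sum>i<k. f (Suc i) * (z ^ Suc i / (1 - z) ^ Suc i))"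
    by (simp add: N sum_distrib_left sum_distrib_right mult_ac)
  then have "(\<lambda>m. N m * z ^ m) sums ((\<Sum>i<k. f (Suc i) * (z ^ Suc i / (1 - z) ^ Suc i)) + N 0 * z ^ 0)"
    by (rule sums_Suc)
  \<comment> \<open>The coefficient at m = 0 accounts for the empty face; \<open>k > 0\<close> makes
    it 1.\<close>
  also have "N 0 = 1"
    using k by (simp add: N_def zero_power)
  also have "(\<Sum>i<k. f (Suc i) * (z ^ Suc i / (1 - z) ^ Suc i)) + 1 * z ^ 0
      = poly (h_poly k (esd_restrict n r G)) z / (1 - z) ^ k"
  proof -
    have "{} \<in> esd_restrict n r G"
      unfolding esd_restrict_def esd_faces_def by (auto simp: is_bchain_def)
    then have "{F \<in> esd_restrict n r G. card F = 0} = {{}}"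
      unfolding esd_restrict_def esd_faces_def by auto
    then have empty: "card {F \<in> esd_restrict n r G. card F = 0} = 1"
      by simp
    have faces: "real (card {F \<in> esd_restrict n r G. card F = Suc i}) = f (Suc i)" for i
      using card_esd_restrict[OF G(1) r, of "Suc i"] by (simp add: f_def)
    have "poly (h_poly k (esd_restrict n r G)) z
        = (\<Sum>i\<le>k. real (card {F \<in> esd_restrict n r G. card F = i}) * (z ^ i * (1 - z) ^ (k - i)))"
      unfolding h_poly_def atLeast0AtMost by (simp add: poly_sum)
    also have "\<dots> = (1 - z) ^ k + (\<Sum>i<k. f (Suc i) * (z ^ Suc i * (1 - z) ^ (k - Suc i)))"
      unfolding lessThan_Suc_atMost[symmetric] sum.lessThan_Suc_shift empty faces by simp
    also have "\<dots> = (1 + (\<Sum>i<k. f (Suc i) * (z ^ Suc i / (1 - z) ^ Suc i))) * (1 - z) ^ k"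
    proof -
      have "(1 - z) ^ (k - Suc i) = (1 - z) ^ k / (1 - z) ^ Suc i" if "i < k" for i
        using that z by (subst power_diff) auto
      then show ?thesis
        unfolding distrib_right sum_distrib_right by (simp add: mult_ac)
    qed
    finally show ?thesis
      using z by (simp add: add.commute)
  qed
  finally show ?thesis
    by (simp add: N_def k_def)
qed

section \<open>The alternating sum over all restrictions\<close>

lemma degree_local_h_esd: "degree (local_h_esd n r) \<le> n"
proof -
  have "degree (h_poly (card G) (esd_restrict n r G)) \<le> n" if "G \<subseteq> {1..n}" for G
  proof -
    have kn: "card G \<le> n"
      using card_mono[OF _ that] by simp
    have "degree ([:0, 1:] ^ i * [:1, -1:] ^ (card G - i) :: real poly) \<le> n" if "i \<le> card G" for i
    proof -
      have "degree ([:0, 1:] ^ i * [:1, -1:] ^ (card G - i) :: real poly) \<le> i + (card G - i)"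
        by (rule order.trans[OF degree_mult_le]) (auto simp: degree_power_eq)
      then show ?thesis
        using that kn by simp
    qed
    then show ?thesis
      unfolding h_poly_def by (intro degree_sum_le) (auto intro: order.trans[OF degree_smult_le])
  qed
  then show ?thesis
    unfolding local_h_esd_def by (intro degree_sum_le) (auto intro: order.trans[OF degree_smult_le])
qed

lemma sum_Pow_alternating:
  fixes u :: real
  shows "(\<Sum>G\<in>Pow {1..n}. (- 1) ^ (n - card G) * u ^ card G) = (u - 1) ^ n"
proof -
  have "(u - 1) ^ n = (\<Prod>i\<in>{1..n}. u + - 1)"
    by simp
  also have "\<dots> = (\<Sum>G\<in>Pow {1..n}. (\<Prod>i\<in>G. u) * (\<Prod>i\<in>{1..n} - G. - 1))"
    by (rule prod_add) simp
  also have "\<dots> = (\<Sum>G\<in>Pow {1..n}. (- 1) ^ (n - card G) * u ^ card G)"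
  proof (intro sum.cong refl)
    fix G assume "G \<in> Pow {1..n}"
    then have "card ({1..n} - G) = n - card G"
      by (auto simp: card_Diff_subset finite_subset)
    then show "(\<Prod>i\<in>G. u) * (\<Prod>i\<in>{1..n} - G. - 1) = (- 1) ^ (n - card G) * u ^ card G"
      by simp
  qed
  finally show ?thesis ..
qed

text \<open>After multiplication by the power of 1 - z, the coefficients are powers of
  \<open>u m\<close> and \<open>v m\<close> with exponent \<open>card G\<close>, so the alternating
  sum over \<open>G\<close> collapses to n-th powers of \<open>u m - 1\<close> and
  \<open>v m - 1\<close>. The two series are then instances of \<open>exc_enum_sums\<close> at
  \<alpha> = cz and \<alpha> = c.\<close>

lemma poly_local_h_esd:
  assumes n: "n > 0" and r: "r > 0" and z: "0 < z" "z < 1"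
  defines "c \<equiv> (real r - 1) / real r"
  shows "(1 - z) * poly (local_h_esd n r) z
    = real r ^ n * (exc_enum n (c * z) z 1 - z * exc_enum n c z 1)"
proof -
  define u where "u m = (1 - z) * (real r * real m + 1)" for m :: nat
  define v where "v m = (1 - z) * (real r * real m)" for m :: nat
  define h where "h G = poly (h_poly (card G) (esd_restrict n r G)) z" for G
  have h_empty: "h {} = 1"
  proof -
    have "{F \<in> esd_restrict n r {}. card F = 0} = {{}}"
      unfolding esd_restrict_def esd_faces_def by (auto simp: is_bchain_def)
    then show ?thesis
      by (simp add: h_def h_poly_def)
  qed
  \<comment> \<open>The empty set has h-polynomial 1 but contributes the zero series, hence the
    correction.\<close>
  have G: "(\<lambda>m. (- 1) ^ (n - card G) * (u m ^ card G - v m ^ card G) * z ^ m) sums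
      ((- 1) ^ (n - card G) * h G - (if G = {} then (- 1) ^ n else 0))" if "G \<in> Pow {1..n}" for G
  proof (cases "G = {}")
    case True
    then show ?thesis
      by (simp add: h_empty)
  next
    case False
    have "(\<lambda>m. (- 1) ^ (n - card G) * (1 - z) ^ card G *
        (((real r * real m + 1) ^ card G - (real r * real m) ^ card G) * z ^ m)) sums
      ((- 1) ^ (n - card G) * (1 - z) ^ card G * (h G / (1 - z) ^ card G))"
      unfolding h_def using that False r z by (intro sums_mult poly_h_poly_esd_sums) auto
    moreover have "u m ^ card G = (1 - z) ^ card G * (real r * real m + 1) ^ card G"
      "v m ^ card G = (1 - z) ^ card G * (real r * real m) ^ card G" for m
      unfolding u_def v_def by (rule power_mult_distrib)+
    ultimately show ?thesis
      using False z by (simp add: mult.assoc flip: right_diff_distrib)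
  qed
  have "(\<lambda>m. \<Sum>G\<in>Pow {1..n}. (- 1) ^ (n - card G) * (u m ^ card G - v m ^ card G) * z ^ m) sums
      (\<Sum>G\<in>Pow {1..n}. (- 1) ^ (n - card G) * h G - (if G = {} then (- 1) ^ n else 0))"
    by (rule sums_sum) (rule G)
  moreover have "(\<Sum>G\<in>Pow {1..n}. (- 1) ^ (n - card G) * (u m ^ card G - v m ^ card G) * z ^ m)
      = ((u m - 1) ^ n - (v m - 1) ^ n) * z ^ m" for m
    unfolding sum_Pow_alternating[symmetric] by (simp add: sum_distrib_left sum_distrib_right sum_subtractf algebra_simps)
  moreover have "(\<Sum>G\<in>Pow {1..n}. (- 1) ^ (n - card G) * h G - (if G = {} then (- 1) ^ n else 0))
      = poly (local_h_esd n r) z - (- 1) ^ n"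
    by (simp add: local_h_esd_def poly_sum h_def sum_subtractf)
  ultimately have L: "(\<lambda>m. ((u m - 1) ^ n - (v m - 1) ^ n) * z ^ m) sums (poly (local_h_esd n r) z - (- 1) ^ n)"
    by simp
  have cr: "real r * c = real r - 1"
    using r by (simp add: c_def)
  have "real r * ((1 - z) * (real m + 1) + (c * z - 1)) = u m - 1" for m
  proof -
    have "real r * ((1 - z) * (real m + 1) + (c * z - 1)) = (1 - z) * real r * (real m + 1) + real r * c * z - real r"
      by (simp add: algebra_simps)
    then show ?thesis
      unfolding cr u_def by (simp add: algebra_simps)
  qed
  then have "(u m - 1) ^ n = real r ^ n * ((1 - z) * (real m + 1) + (c * z - 1)) ^ n" for m
    by (metis power_mult_distrib)
  then have U: "(\<lambda>m. (u m - 1) ^ n * z ^ m) sums (real r ^ n * (exc_enum n (c * z) z 1 / (1 - z)))"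
    using sums_mult[OF exc_enum_sums[of z "c * z - 1" n], of "real r ^ n"] z by (simp add: mult.assoc)
  \<comment> \<open>The index of \<open>v\<close> must be shifted by one to fit
    \<open>exc_enum_sums\<close>: this produces the factor \<open>z\<close>, and the split-off term
    at m = 0 cancels the correction for the empty set.\<close>
  have "real r * ((1 - z) * (real m + 1) + (c - 1)) = v (Suc m) - 1" for m
  proof -
    have "real r * ((1 - z) * (real m + 1) + (c - 1)) = (1 - z) * real r * (real m + 1) + real r * c - real r"
      by (simp add: algebra_simps)
    then show ?thesis
      unfolding cr v_def by (simp add: algebra_simps)
  qed
  then have "(v (Suc m) - 1) ^ n = real r ^ n * ((1 - z) * (real m + 1) + (c - 1)) ^ n" for m
    by (metis power_mult_distrib)
  then have "(\<lambda>m. (v (Suc m) - 1) ^ n * z ^ Suc m) sums (z * real r ^ n * (exc_enum n c z 1 / (1 - z)))"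
    using sums_mult[OF exc_enum_sums[of z "c - 1" n], of "z * real r ^ n"] z by (simp add: mult_ac)
  then have "(\<lambda>m. (v m - 1) ^ n * z ^ m) sums
      (z * real r ^ n * (exc_enum n c z 1 / (1 - z)) + (v 0 - 1) ^ n * z ^ 0)"
    by (rule sums_Suc)
  from sums_diff[OF U this] have "(\<lambda>m. ((u m - 1) ^ n - (v m - 1) ^ n) * z ^ m) sums
     (real r ^ n * (exc_enum n (c * z) z 1 / (1 - z)) - (z * real r ^ n * (exc_enum n c z 1 / (1 - z)) + (- 1) ^ n))"
    by (simp add: v_def left_diff_distrib)
  with L have "poly (local_h_esd n r) z
      = real r ^ n * (exc_enum n (c * z) z 1 / (1 - z)) - z * real r ^ n * (exc_enum n c z 1 / (1 - z))"
    by (auto dest: sums_unique2)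
  moreover have "w * (k * (X / w) - z * k * (Y / w)) = k * (X - z * Y)" if "w \<noteq> 0" for k w X Y :: real
    using that by (simp add: field_simps)
  ultimately show ?thesis
    using z by simp
qed

lemma real_rooted_local_h_esd:
  assumes n: "n > 0" and r: "r > 0"
  shows "real_rooted (local_h_esd n r)"
proof -
  define c where "c = (real r - 1) / real r"
  have "[:1, -1:] * local_h_esd n r
      = smult (real r ^ n) (exc_enum n [:0, c:] [:0, 1:] 1 - [:0, 1:] * exc_enum n [:c:] [:0, 1:] 1)"
    using poly_local_h_esd[OF n r]
    by (intro poly_eqI_open_interval[of 0 1]) (simp_all add: poly_exc_enum c_def mult.commute left_diff_distrib)
  then have *: "poly ([:1, -1:] * local_h_esd n r) z
      = poly (smult (real r ^ n) (exc_enum n [:0, c:] [:0, 1:] 1 - [:0, 1:] * exc_enum n [:c:] [:0, 1:] 1)) z" for z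
    by simp
  show ?thesis
  proof (rule real_rooted_symmetric_part[OF n, of c])
    show "(1 - z) * poly (local_h_esd n r) z
        = real r ^ n * (exc_enum n (c * z) z 1 - z * exc_enum n c z 1)" for z
      using *[of z] by (simp add: poly_exc_enum mult.commute left_diff_distrib)
  qed (use r degree_local_h_esd in \<open>auto simp: c_def\<close>)
qed

theorem theorem5p1:
  fixes n r :: nat
  assumes "n > 0" and "r > 0"
  shows "(\<forall>a b. In_decomposition n (colored_derangement_poly n r) a b \<longrightarrow>
             real_rooted a \<and> real_rooted b) \<and>
         real_rooted (local_h_esd n r)"
  using In_decomposition_real_rooted[OF assms] real_rooted_local_h_esd[OF assms] by blast

end
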